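(* Let $G$ be a Hausdorff topological group, $\theta$ a nice partial action of $G$ on a topological space $Y$, and $X$ a nonempty compact metrizable space, with $\hat\theta$ the induced partial action on $C(X,Y)$ (compact-open topology). Then the following are equivalent: (i) $Y$ is an ANE; (ii) $Y_G$ is an ANE; (iii) $C(X,Y)_G$ is an ANE; (iv) $C(X,Y)$ is an ANE.
   Context: A topological partial action of $G$ on $Y$ is a family of homeomorphisms $\theta_g\colon Y_{g^{-1}}\to Y_g$ between open subsets with $Y_e=Y$, $\theta_e=\mathrm{id}_Y$, $\theta_{g^{-1}}=\theta_g^{-1}$, $\theta_g\circ\theta_h$ a restriction of $\theta_{gh}$; it is nice if $G*Y=\{(g,y): y\in Y_{g^{-1}}\}$ is open in $G\times Y$ and $(g,y)\mapsto\theta_g(y)$ is continuous on $G*Y$. $\hat\theta$ has $C(X,Y)_g=\{f: f(X)\subset Y_g\}$ and $\hat\theta_g(f)=\theta_g\circ f$. For a topological partial action on $W$, the enveloping space is $W_G=(G\times W)/R$ with the quotient topology, where $(g,x)R(h,y)$ iff $x\in W_{g^{-1}h}$ and $\theta_{h^{-1}g}(x)=y$. A space $W$ is an ANE (absolute neighborhood extensor) if for every metrizable space $Z$, every closed $A\subset Z$ and every continuous $f\colon A\to W$ there is a continuous extension of $f$ to some neighborhood of $A$ in $Z$. *)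

theory Defs
  imports "HOL-Analysis.Analysis" "HOL-Algebra.Group"
begin

definition topological_group :: "('g, 'b) monoid_scheme \<Rightarrow> 'g topology \<Rightarrow> bool" where
  "topological_group G T \<longleftrightarrow>
     group G \<and> topspace T = carrier G \<and>
     continuous_map (prod_topology T T) T (\<lambda>(g, h). g \<otimes>\<^bsub>G\<^esub> h) \<and>
     continuous_map T T (\<lambda>g. inv\<^bsub>G\<^esub> g)"

definition topological_partial_action ::
  "('g, 'b) monoid_scheme \<Rightarrow> 'y topology \<Rightarrow> ('g \<Rightarrow> 'y set) \<Rightarrow> ('g \<Rightarrow> 'y \<Rightarrow> 'y) \<Rightarrow> bool" where
  "topological_partial_action G Y D th \<longleftrightarrow>
     (\<forall>g \<in> carrier G. openin Y (D g)) \<and>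
     D \<one>\<^bsub>G\<^esub> = topspace Y \<and>
     (\<forall>y \<in> topspace Y. th \<one>\<^bsub>G\<^esub> y = y) \<and>
     (\<forall>g \<in> carrier G. homeomorphic_maps (subtopology Y (D (inv\<^bsub>G\<^esub> g))) (subtopology Y (D g))
                          (th g) (th (inv\<^bsub>G\<^esub> g))) \<and>
     (\<forall>g \<in> carrier G. \<forall>h \<in> carrier G. \<forall>y \<in> D (inv\<^bsub>G\<^esub> h).
        th h y \<in> D (inv\<^bsub>G\<^esub> g) \<longrightarrow>
          y \<in> D (inv\<^bsub>G\<^esub> (g \<otimes>\<^bsub>G\<^esub> h)) \<and> th g (th h y) = th (g \<otimes>\<^bsub>G\<^esub> h) y)"

definition nice_partial_action ::
  "('g, 'b) monoid_scheme \<Rightarrow> 'g topology \<Rightarrow> 'y topology \<Rightarrow> ('g \<Rightarrow> 'y set) \<Rightarrow> ('g \<Rightarrow> 'y \<Rightarrow> 'y) \<Rightarrow> bool" where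
  "nice_partial_action G T Y D th \<longleftrightarrow>
     topological_partial_action G Y D th \<and>
     openin (prod_topology T Y) {(g, y). g \<in> carrier G \<and> y \<in> D (inv\<^bsub>G\<^esub> g)} \<and>
     continuous_map (subtopology (prod_topology T Y) {(g, y). g \<in> carrier G \<and> y \<in> D (inv\<^bsub>G\<^esub> g)})
                    Y (\<lambda>(g, y). th g y)"

definition cmaps :: "'x topology \<Rightarrow> 'y topology \<Rightarrow> ('x \<Rightarrow> 'y) set" where
  "cmaps X Y = {f. continuous_map X Y f \<and> (\<forall>x. x \<notin> topspace X \<longrightarrow> f x = undefined)}"

definition compact_open_topology :: "'x topology \<Rightarrow> 'y topology \<Rightarrow> ('x \<Rightarrow> 'y) topology" where
  "compact_open_topology X Y =
     topology_generated_by {{f \<in> cmaps X Y. f ` K \<subseteq> U} | K U. compactin X K \<and> openin Y U}"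

definition hat_dom :: "'x topology \<Rightarrow> 'y topology \<Rightarrow> ('g \<Rightarrow> 'y set) \<Rightarrow> 'g \<Rightarrow> ('x \<Rightarrow> 'y) set" where
  "hat_dom X Y D g = {f \<in> cmaps X Y. f ` topspace X \<subseteq> D g}"

definition hat_act :: "'x topology \<Rightarrow> ('g \<Rightarrow> 'y \<Rightarrow> 'y) \<Rightarrow> 'g \<Rightarrow> ('x \<Rightarrow> 'y) \<Rightarrow> ('x \<Rightarrow> 'y)" where
  "hat_act X th g f = (\<lambda>x. if x \<in> topspace X then th g (f x) else undefined)"

definition envelope_rel ::
  "('g, 'b) monoid_scheme \<Rightarrow> 'w topology \<Rightarrow> ('g \<Rightarrow> 'w set) \<Rightarrow> ('g \<Rightarrow> 'w \<Rightarrow> 'w) \<Rightarrow> (('g \<times> 'w) \<times> ('g \<times> 'w)) set" where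
  "envelope_rel G W D th =
     {((g, x), (h, y)). g \<in> carrier G \<and> h \<in> carrier G \<and> x \<in> topspace W \<and>
        x \<in> D (inv\<^bsub>G\<^esub> g \<otimes>\<^bsub>G\<^esub> h) \<and> th (inv\<^bsub>G\<^esub> h \<otimes>\<^bsub>G\<^esub> g) x = y}"

definition quotient_topology :: "'a topology \<Rightarrow> ('a \<times> 'a) set \<Rightarrow> 'a set topology" where
  "quotient_topology P R =
     topology (\<lambda>U. U \<subseteq> topspace P // R \<and> openin P (\<Union>U))"

definition enveloping_space ::
  "('g, 'b) monoid_scheme \<Rightarrow> 'g topology \<Rightarrow> 'w topology \<Rightarrow> ('g \<Rightarrow> 'w set) \<Rightarrow> ('g \<Rightarrow> 'w \<Rightarrow> 'w)
     \<Rightarrow> ('g \<times> 'w) set topology" where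
  "enveloping_space G T W D th = quotient_topology (prod_topology T W) (envelope_rel G W D th)"

definition ANE :: "'z itself \<Rightarrow> 'a topology \<Rightarrow> bool" where
  "ANE _ W \<longleftrightarrow>
     (\<forall>(Z :: 'z topology) A f. metrizable_space Z \<and> closedin Z A \<and> continuous_map (subtopology Z A) W f
        \<longrightarrow> (\<exists>U g. openin Z U \<and> A \<subseteq> U \<and> continuous_map (subtopology Z U) W g \<and>
                   (\<forall>z \<in> A. g z = f z)))"

end

theory Submission
  imports Defs
begin

text \<open>
  Every map \<open>y \<mapsto> [(g, y)]\<close> is an open embedding of \<open>W\<close> into the enveloping space \<open>W\<^sub>G\<close> of a nice
  partial action, and the images cover \<open>W\<^sub>G\<close>. Open subsets of an ANE are ANEs, and a space covered by
  open ANEs is an ANE, so \<open>W\<close> is an ANE iff \<open>W\<^sub>G\<close> is. The induced action on \<open>C(X,Y)\<close> is again nice,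
  so it remains to compare \<open>Y\<close> and \<open>C(X,Y)\<close>. The constant maps make \<open>Y\<close> a retract of \<open>C(X,Y)\<close>; conversely,
  a map \<open>A \<rightarrow> C(X,Y)\<close> is extended by extending its uncurried form \<open>A \<times> X \<rightarrow> Y\<close> and applying the tube lemma.

  In the local-to-global step, a map \<open>f : A \<rightarrow> W\<close> pulls the cover of \<open>W\<close> back to \<open>A\<close>; a well-ordering of
  the cover splits \<open>A\<close> into countably many uniformly discrete families of closed sets, and \<open>f\<close> is extended
  to closed neighbourhoods of these families one after the other.

  The test spaces in \<open>ANE TYPE('z)\<close> live on the type \<open>'z\<close>, which need not contain a copy of \<open>Z \<times> X\<close>. It does
  if \<open>'z\<close> has at least the cardinality of the continuum, since \<open>X\<close> is compact and metrizable. Otherwise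
  every metrizable space on \<open>'z\<close> is strongly zero-dimensional, its nonempty closed subsets are retracts,
  and every space is an ANE with respect to \<open>'z\<close>.
\<close>

section \<open>Spaces covered by open ANEs\<close>

text \<open>This is the sigma-discrete closed refinement of Stone's theorem on metric spaces in
  quantitative form: on level \<open>n\<close> the radius \<open>1 / Suc n\<close> measures both the
  room inside \<open>U i\<close> and the distance between members with different indices.\<close>

definition (in Metric_space) discrete_refinement :: "'i set \<Rightarrow> ('i \<Rightarrow> 'a set) \<Rightarrow> (nat \<Rightarrow> 'i \<Rightarrow> 'a set) \<Rightarrow> bool" where
  "discrete_refinement I U F \<longleftrightarrow>
     (\<forall>n. \<forall>i\<in>I. closedin mtopology (F n i)) \<and>
     (\<forall>n. \<forall>i\<in>I. \<forall>x\<in>F n i. mball x (1 / Suc n) \<subseteq> U i) \<and>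
     (\<forall>n. \<forall>i\<in>I. \<forall>j\<in>I. i \<noteq> j \<longrightarrow> (\<forall>x\<in>F n i. \<forall>y\<in>F n j. 1 / Suc n \<le> d x y)) \<and>
     (\<Union>i\<in>I. U i) \<subseteq> (\<Union>n. \<Union>i\<in>I. F n i)"

text \<open>\<open>F n i\<close> consists of the points of \<open>U i\<close> deeper than \<open>1 / Suc n\<close> that lie in no earlier member of the cover.\<close>

lemma (in Metric_space) discrete_refinement_exists:
  fixes U :: "'i \<Rightarrow> 'a set"
  assumes opn: "\<And>i. i \<in> I \<Longrightarrow> openin mtopology (U i)"
  shows "\<exists>F. discrete_refinement I U F"
proof -
  obtain r :: "'i rel" where r: "Well_order r \<and> Field r = UNIV"
    using well_ordering[where 'a='i] by (rule exE)
  define s where "s = r - Id"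
  have wf: "wf s"
    using r by (simp add: s_def well_order_on_def)
  have tot: "(i, j) \<in> s \<or> (j, i) \<in> s" if "i \<noteq> j" for i j
    using r that by (simp add: s_def well_order_on_def linear_order_on_def total_on_def)
  define F where "F = (\<lambda>(n::nat) i. {x \<in> M. mball x (1 / Suc n) \<subseteq> U i \<and> (\<forall>j\<in>I. (j, i) \<in> s \<longrightarrow> x \<notin> U j)})"
  have UM: "x \<in> M" if "x \<in> U i" "i \<in> I" for x i
    using openin_subset[OF opn[OF that(2)]] that by auto
  have "discrete_refinement I U F"
    unfolding discrete_refinement_def
  proof (intro conjI allI ballI impI)
    show "closedin mtopology (F n i)" if "i \<in> I" for n i
    proof -
      \<comment> \<open>The ball condition fails at \<open>x\<close> exactly when \<open>x\<close>
        lies in a ball of the same radius about some point outside \<open>U i\<close>, so the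
        complement is a union of open sets.\<close>
      have "M - F n i = (\<Union>y\<in>M - U i. mball y (1 / Suc n)) \<union> (\<Union>j\<in>{j\<in>I. (j, i) \<in> s}. U j)"
        using UM by (auto simp: F_def commute subset_iff)
      moreover have "openin mtopology \<dots>"
        using opn by (intro openin_Un openin_Union) auto
      ultimately show ?thesis
        by (auto simp: closedin_def F_def)
    qed
    show "mball x (1 / Suc n) \<subseteq> U i" if "i \<in> I" "x \<in> F n i" for n i x
      using that by (auto simp: F_def)
    \<comment> \<open>If a point \<open>y\<close> of the later member were closer, it would lie in
      the ball around \<open>x\<close> and hence in \<open>U i\<close>, which membership in
      \<open>F n j\<close> forbids.\<close>
    have *: "1 / Suc n \<le> d x y" if "i \<in> I" "(i, j) \<in> s" "x \<in> F n i" "y \<in> F n j" for n i j x y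
    proof (rule ccontr)
      assume "\<not> ?thesis"
      then have "y \<in> mball x (1 / Suc n)"
        using that by (simp add: F_def)
      then show False
        using that by (auto simp: F_def)
    qed
    show "1 / Suc n \<le> d x y" if "i \<in> I" "j \<in> I" "i \<noteq> j" "x \<in> F n i" "y \<in> F n j" for n i j x y
      using tot[OF \<open>i \<noteq> j\<close>] *[of i j x n y] *[of j i y n x] that by (auto simp: commute)
    show "(\<Union>i\<in>I. U i) \<subseteq> (\<Union>n. \<Union>i\<in>I. F n i)"
    proof
      fix x assume "x \<in> (\<Union>i\<in>I. U i)"
      then obtain k where "k \<in> {i\<in>I. x \<in> U i}"
        by auto
      \<comment> \<open>At the least index whose set contains \<open>x\<close>, the condition of
        avoiding all earlier sets holds.\<close>
      then obtain i where i: "i \<in> I" "x \<in> U i" and min: "\<And>j. (j, i) \<in> s \<Longrightarrow> j \<notin> {i\<in>I. x \<in> U i}"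
        by (rule wfE_min[OF wf]) auto
      obtain e where "e > 0" "mball x e \<subseteq> U i"
        using opn[OF i(1)] i(2) unfolding openin_mtopology by blast
      moreover obtain n where "1 / Suc n < e"
        using nat_approx_posE[OF \<open>e > 0\<close>] by blast
      ultimately have "mball x (1 / Suc n) \<subseteq> U i"
        using mball_subset_concentric[of "1 / Suc n" e x] by auto
      then have "x \<in> F n i"
        using i min UM[of x i] by (auto simp: F_def)
      then show "x \<in> (\<Union>n. \<Union>i\<in>I. F n i)"
        using i by blast
    qed
  qed
  then show ?thesis
    by blast
qed

section \<open>Extending a map to closed neighbourhoods\<close>

lemma ANE_D:
  fixes Z :: "'z topology"
  assumes "ANE TYPE('z) W" "metrizable_space Z" "closedin Z A" "continuous_map (subtopology Z A) W f"
  obtains U g where "openin Z U" "A \<subseteq> U" "continuous_map (subtopology Z U) W g" "\<And>z. z \<in> A \<Longrightarrow> g z = f z"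
  using assms unfolding ANE_def by (metis (no_types, lifting))

text \<open>Close to \<open>F\<close> the map \<open>g\<close> takes values in \<open>V\<close>
  only, so the extension property of \<open>V\<close> applies there. Agreement with \<open>g\<close>
  on all of \<open>M \<inter> C\<close>, not just on \<open>F\<close>, is what later allows
  \<open>h\<close> and \<open>g\<close> to be pasted.\<close>

lemma ANE_extend_near:
  fixes Z :: "'z topology"
  assumes Z: "metrizable_space Z" and C: "closedin Z C"
    and g: "continuous_map (subtopology Z C) W g"
    and V: "openin W V" "ANE TYPE('z) (subtopology W V)"
    and F: "closedin Z F" "F \<subseteq> C" "g ` F \<subseteq> V" and N: "openin Z N" "F \<subseteq> N"
  obtains M h where "closedin Z M" "M \<subseteq> N" "F \<subseteq> Z interior_of M"
    "continuous_map (subtopology Z M) W h" "\<And>z. z \<in> M \<inter> C \<Longrightarrow> h z = g z"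
proof -
  have nrm: "\<exists>V. openin Z V \<and> S \<subseteq> V \<and> Z closure_of V \<subseteq> U" if "closedin Z S" "openin Z U" "S \<subseteq> U" for S U
    using metrizable_imp_normal_space[OF Z] that unfolding normal_space_alt by blast
  \<comment> \<open>At these points \<open>g\<close> leaves \<open>V\<close>. A neighbourhood of
    \<open>F\<close> whose closure misses them keeps \<open>g\<close> inside \<open>V\<close> on its
    intersection with \<open>C\<close>.\<close>
  define E where "E = {z \<in> C. g z \<in> topspace W - V}"
  have CZ: "C \<subseteq> topspace Z"
    using C closedin_subset by auto
  have "closedin (subtopology Z C) {z \<in> topspace (subtopology Z C). g z \<in> topspace W - V}"
    using g V by (intro closedin_continuous_map_preimage) auto
  moreover have "{z \<in> topspace (subtopology Z C). g z \<in> topspace W - V} = E"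
    using CZ by (auto simp: E_def)
  ultimately have E: "closedin Z E"
    using closedin_trans_full C by fastforce
  have gW: "g z \<in> topspace W" if "z \<in> C" for z
    using g that CZ by (auto simp: continuous_map_def Pi_iff)
  obtain O1 where O1: "openin Z O1" "F \<subseteq> O1" "Z closure_of O1 \<subseteq> N - E"
    using nrm[of F "N - E"] F N E by (auto simp: E_def openin_diff)
  define K where "K = Z closure_of O1"
  have K: "closedin Z K"
    by (simp add: K_def)
  have gK: "g ` (C \<inter> K) \<subseteq> V"
    using O1 gW by (force simp: K_def E_def)
  have CK: "closedin Z (C \<inter> K)"
    using C K by blast
  have "continuous_map (subtopology Z (C \<inter> K)) (subtopology W V) g"
    using g gK by (auto simp: continuous_map_in_subtopology intro: continuous_map_from_subtopology_mono)
  then obtain U h where U: "openin Z U" "C \<inter> K \<subseteq> U" and h: "continuous_map (subtopology Z U) (subtopology W V) h"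
    "\<And>z. z \<in> C \<inter> K \<Longrightarrow> h z = g z"
    using ANE_D[OF V(2) Z CK] by metis
  \<comment> \<open>A second use of normality replaces the open domain \<open>U\<close> of
    \<open>h\<close> by a closed set that still contains a neighbourhood of
    \<open>F\<close>.\<close>
  obtain O2 where O2: "openin Z O2" "C \<inter> K \<subseteq> O2" "Z closure_of O2 \<subseteq> U"
    using nrm[OF CK U] by blast
  have sub: "O1 \<subseteq> K" "O2 \<subseteq> Z closure_of O2"
    unfolding K_def using O1 O2 by (auto intro!: closure_of_subset openin_subset)
  show thesis
  proof
    show "closedin Z (K \<inter> Z closure_of O2)"
      using K by (simp add: closedin_Int)
    show "K \<inter> Z closure_of O2 \<subseteq> N"
      using O1 by (auto simp: K_def)
    show "F \<subseteq> Z interior_of (K \<inter> Z closure_of O2)"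
    proof -
      have "O1 \<inter> O2 \<subseteq> Z interior_of (K \<inter> Z closure_of O2)"
        using O1 O2 sub by (intro interior_of_maximal) auto
      then show ?thesis
        using O1 O2 F sub by blast
    qed
    show "continuous_map (subtopology Z (K \<inter> Z closure_of O2)) W h"
      using h(1) O2(3) continuous_map_into_fulltopology
      by (metis continuous_map_from_subtopology_mono le_infI2)
    show "h z = g z" if "z \<in> K \<inter> Z closure_of O2 \<inter> C" for z
      using that h by auto
  qed
qed

text \<open>Each \<open>F i\<close> is treated separately within distance \<open>e / 3\<close>. The
  resulting closed pieces stay apart from each other, so together with \<open>C\<close> they form a
  locally finite closed family, and the local extensions paste.\<close>

lemma (in Metric_space) ANE_extend_near_discrete_family:
  fixes F :: "'i \<Rightarrow> 'a set"
  assumes C: "closedin mtopology C" and g: "continuous_map (subtopology mtopology C) W g"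
    and V: "\<And>i. i \<in> I \<Longrightarrow> openin W (V i)" "\<And>i. i \<in> I \<Longrightarrow> ANE TYPE('a) (subtopology W (V i))"
    and F: "\<And>i. i \<in> I \<Longrightarrow> closedin mtopology (F i)" "\<And>i. i \<in> I \<Longrightarrow> F i \<subseteq> C"
      "\<And>i. i \<in> I \<Longrightarrow> g ` F i \<subseteq> V i"
    and e: "e > 0" "\<And>i j x y. i \<in> I \<Longrightarrow> j \<in> I \<Longrightarrow> i \<noteq> j \<Longrightarrow> x \<in> F i \<Longrightarrow> y \<in> F j \<Longrightarrow> e \<le> d x y"
  obtains C' g' where "closedin mtopology C'" "C \<subseteq> C'" "continuous_map (subtopology mtopology C') W g'"
    "\<And>z. z \<in> C \<Longrightarrow> g' z = g z" "(\<Union>i\<in>I. F i) \<subseteq> mtopology interior_of C'"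
proof -
  define N where "N i = (\<Union>x\<in>F i. mball x (e / 3))" for i
  have N: "openin mtopology (N i)" "F i \<subseteq> N i" if "i \<in> I" for i
    using F(1)[OF that] closedin_subset \<open>e > 0\<close> unfolding N_def by fastforce+
  define P where "P i K h \<longleftrightarrow> closedin mtopology K \<and> K \<subseteq> N i \<and> F i \<subseteq> mtopology interior_of K \<and>
    continuous_map (subtopology mtopology K) W h \<and> (\<forall>z. z \<in> K \<inter> C \<longrightarrow> h z = g z)" for i K h
  have "\<exists>K h. P i K h" if i: "i \<in> I" for i
  proof -
    obtain K h where "closedin mtopology K" "K \<subseteq> N i" "F i \<subseteq> mtopology interior_of K"
      "continuous_map (subtopology mtopology K) W h" "\<And>z. z \<in> K \<inter> C \<Longrightarrow> h z = g z"
      using ANE_extend_near[OF metrizable_space_mtopology C g V(1)[OF i] V(2)[OF i] F(1)[OF i]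
        F(2)[OF i] F(3)[OF i] N(1)[OF i] N(2)[OF i]] by metis
    then show ?thesis
      unfolding P_def by blast
  qed
  then obtain K h where Kh: "\<And>i. i \<in> I \<Longrightarrow> P i (K i) (h i)"
    by metis
  then have K: "\<And>i. i \<in> I \<Longrightarrow> closedin mtopology (K i)" "\<And>i. i \<in> I \<Longrightarrow> K i \<subseteq> N i"
    "\<And>i. i \<in> I \<Longrightarrow> F i \<subseteq> mtopology interior_of (K i)"
    and h: "\<And>i. i \<in> I \<Longrightarrow> continuous_map (subtopology mtopology (K i)) W (h i)"
      "\<And>i z. i \<in> I \<Longrightarrow> z \<in> K i \<Longrightarrow> z \<in> C \<Longrightarrow> h i z = g z"
    by (auto simp: P_def)
  \<comment> \<open>Passing from \<open>F i\<close> and \<open>F j\<close> to points within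
    \<open>e / 3\<close> of them uses up at most two thirds of the gap \<open>e\<close>.\<close>
  have sep: "i = j" if ij: "i \<in> I" "j \<in> I" and pq: "p \<in> K i" "q \<in> K j" "d p q < e / 3" for i j p q
  proof (rule ccontr)
    assume "i \<noteq> j"
    obtain x y where "x \<in> F i" "y \<in> F j" and *: "x \<in> M" "y \<in> M" "p \<in> M" "q \<in> M" "d x p < e / 3" "d y q < e / 3"
      using K(2)[OF ij(1)] K(2)[OF ij(2)] pq by (force simp: N_def)
    then have "e \<le> d x y"
      using e(2)[OF ij(1) ij(2) \<open>i \<noteq> j\<close>] by blast
    moreover have "d x y \<le> d x p + d p q + d y q"
      using triangle[of x p y] triangle[of p q y] * by (simp add: commute)
    ultimately show False
      using * pq by linarith
  qed
  \<comment> \<open>\<open>None\<close> indexes the old domain \<open>C\<close> and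
    \<open>Some i\<close> the new piece \<open>K i\<close>, so that one pasting argument covers
    both.\<close>
  define T where "T = case_option C K"
  define k where "k = case_option g h"
  define J where "J = insert None (Some ` I)"
  define C' where "C' = (\<Union>j\<in>J. T j)"
  have T: "closedin mtopology (T j)" if "j \<in> J" for j
    using that C K by (auto simp: J_def T_def)
  have TM: "T j \<subseteq> M" if "j \<in> J" for j
    using T[OF that] closedin_subset by fastforce
  have fin: "\<exists>V. openin mtopology V \<and> x \<in> V \<and> finite {j \<in> J. T j \<inter> V \<noteq> {}}" if "x \<in> M" for x
  proof (intro exI conjI)
    \<comment> \<open>Two points of this ball are less than \<open>e / 3\<close> apart, so it meets
      at most one \<open>K i\<close>.\<close>
    define B where "B = mball x (e / 6)"
    have "i = j" if ij: "i \<in> I" "j \<in> I" "K i \<inter> B \<noteq> {}" "K j \<inter> B \<noteq> {}" for i j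
    proof -
      obtain p q where "p \<in> K i" "q \<in> K j" and *: "p \<in> M" "q \<in> M" "d x p < e / 6" "d x q < e / 6"
        using ij by (auto simp: B_def)
      moreover have "d p q < e / 3"
        using triangle''[of p x q] * \<open>x \<in> M\<close> by linarith
      ultimately show ?thesis
        using sep ij by blast
    qed
    then have *: "{i\<in>I. K i \<inter> B \<noteq> {}} \<subseteq> {k}" if "k \<in> {i\<in>I. K i \<inter> B \<noteq> {}}" for k
      using that by blast
    have "finite {i\<in>I. K i \<inter> B \<noteq> {}}"
    proof (cases "{i\<in>I. K i \<inter> B \<noteq> {}} = {}")
      case True
      then show ?thesis by (simp only: finite.emptyI)
    next
      case False
      then obtain k where "k \<in> {i\<in>I. K i \<inter> B \<noteq> {}}"
        by blast
      from finite_subset[OF *[OF this]] show ?thesis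
        by simp
    qed
    moreover have "{j \<in> J. T j \<inter> B \<noteq> {}} \<subseteq> insert None (Some ` {i\<in>I. K i \<inter> B \<noteq> {}})"
      unfolding J_def T_def by (auto simp: image_iff)
    ultimately show "finite {j \<in> J. T j \<inter> B \<noteq> {}}"
      using finite_subset by blast
    show "openin mtopology B" "x \<in> B"
      using \<open>e > 0\<close> that by (auto simp: B_def)
  qed
  have C': "closedin mtopology C'"
    unfolding C'_def
  proof (rule closedin_locally_finite_Union)
    show "locally_finite_in mtopology (T ` J)"
      unfolding locally_finite_in_def
    proof (intro conjI ballI)
      show "\<Union> (T ` J) \<subseteq> topspace mtopology"
        using TM by auto
      fix x assume "x \<in> topspace mtopology"
      then obtain V where V: "openin mtopology V" "x \<in> V" "finite {j \<in> J. T j \<inter> V \<noteq> {}}"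
        using fin by auto
      have "{U \<in> T ` J. U \<inter> V \<noteq> {}} = T ` {j \<in> J. T j \<inter> V \<noteq> {}}"
        by auto
      then have "finite {U \<in> T ` J. U \<inter> V \<noteq> {}}"
        using V(3) by simp
      then show "\<exists>V. openin mtopology V \<and> x \<in> V \<and> finite {U \<in> T ` J. U \<inter> V \<noteq> {}}"
        using V(1,2) by blast
    qed
  qed (use T in auto)
  have C'M: "C' \<subseteq> M"
    using TM by (auto simp: C'_def)
  have agree: "k i x = k j x" if "i \<in> J" "j \<in> J" "x \<in> T i" "x \<in> T j" for i j x
  proof -
    show ?thesis
    proof (cases "i = None \<or> j = None")
      case True
      then show ?thesis
        using that h by (auto simp: J_def T_def k_def)
    next
      case False
      then obtain i' j' where ij: "i = Some i'" "j = Some j'"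
        by auto
      \<comment> \<open>This is \<open>sep\<close> at distance zero: pieces with different indices
        are disjoint.\<close>
      then have "i' = j'"
        using sep[of i' j' x x] that TM[OF \<open>i \<in> J\<close>] \<open>e > 0\<close> by (auto simp: J_def T_def)
      then show ?thesis
        using ij by simp
    qed
  qed
  define g' where "g' = (\<lambda>x. k (SOME j. j \<in> J \<and> x \<in> T j) x)"
  have g'k: "g' x = k j x" if "j \<in> J" "x \<in> T j" for x j
    using someI[of "\<lambda>j. j \<in> J \<and> x \<in> T j" j] that agree unfolding g'_def by blast
  have g': "continuous_map (subtopology mtopology C') W g'"
  proof (rule pasting_lemma_locally_finite[where I = J and T = T and f = k])
    fix x assume x: "x \<in> topspace (subtopology mtopology C')"
    then obtain V where V: "openin mtopology V" "x \<in> V" "finite {j \<in> J. T j \<inter> V \<noteq> {}}"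
      using fin by auto
    have "{j \<in> J. T j \<inter> (V \<inter> C') \<noteq> {}} \<subseteq> {j \<in> J. T j \<inter> V \<noteq> {}}"
      by auto
    then have "finite {j \<in> J. T j \<inter> (V \<inter> C') \<noteq> {}}"
      using V finite_subset by blast
    then show "\<exists>V. openin (subtopology mtopology C') V \<and> x \<in> V \<and> finite {j \<in> J. T j \<inter> V \<noteq> {}}"
      using V x by (intro exI[of _ "V \<inter> C'"]) (auto simp: openin_subtopology_Int)
    show "\<exists>j. j \<in> J \<and> x \<in> T j \<and> g' x = k j x"
      using x g'k by (auto simp: C'_def)
  next
    show "closedin (subtopology mtopology C') (T j)" if "j \<in> J" for j
      using T[OF that] that by (intro closedin_subset_topspace) (auto simp: C'_def)
    show "continuous_map (subtopology (subtopology mtopology C') (T j)) W (k j)" if "j \<in> J" for j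
    proof -
      have "continuous_map (subtopology mtopology (T j)) W (k j)"
        using that g h by (auto simp: J_def T_def k_def)
      moreover have "C' \<inter> T j = T j"
        using that by (auto simp: C'_def)
      ultimately show ?thesis
        by (simp add: subtopology_subtopology)
    qed
    show "k i x = k j x" if "i \<in> J" "j \<in> J" "x \<in> topspace (subtopology mtopology C') \<inter> T i \<inter> T j" for i j x
      using agree that by blast
  qed
  have TC': "T j \<subseteq> C'" if "j \<in> J" for j
    using that by (auto simp: C'_def)
  show thesis
  proof
    show "C \<subseteq> C'"
      using TC'[of None] by (simp add: J_def T_def)
    show "g' z = g z" if "z \<in> C" for z
      using g'k[of None z] that by (auto simp: J_def T_def k_def)
    show "(\<Union>i\<in>I. F i) \<subseteq> mtopology interior_of C'"
    proof
      fix x assume "x \<in> (\<Union>i\<in>I. F i)"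
      then obtain i where i: "i \<in> I" "x \<in> mtopology interior_of (K i)"
        using K by blast
      moreover have "K i \<subseteq> C'"
        using TC'[of "Some i"] i by (simp add: J_def T_def)
      ultimately show "x \<in> mtopology interior_of C'"
        using interior_of_mono by blast
    qed
  qed (use C' g' in auto)
qed

text \<open>Each level of the refinement is absorbed into the interior of the next closed domain. At
  the end the interiors are glued and not the closed domains, since pasting along open sets requires
  no local finiteness.\<close>

proposition ANE_if_union_of_open_ANE:
  fixes W :: "'w topology"
  assumes V: "\<And>i. i \<in> I \<Longrightarrow> openin W (V i)" "\<And>i. i \<in> I \<Longrightarrow> ANE TYPE('z) (subtopology W (V i))"
    and cov: "topspace W \<subseteq> (\<Union>i\<in>I. V i)"
  shows "ANE TYPE('z) W"
  unfolding ANE_def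
proof (intro allI impI)
  fix Z :: "'z topology" and A f
  assume "metrizable_space Z \<and> closedin Z A \<and> continuous_map (subtopology Z A) W f"
  then obtain M d where "Metric_space M d" and Z: "Z = Metric_space.mtopology M d"
    and A: "closedin Z A" and f: "continuous_map (subtopology Z A) W f"
    unfolding metrizable_space_def by blast
  then interpret Metric_space M d by blast
  have AM: "A \<subseteq> M"
    using A closedin_subset by (fastforce simp: Z)
  have fW: "f z \<in> topspace W" if "z \<in> A" for z
    using f that AM by (auto simp: continuous_map_def Z Pi_iff)
  \<comment> \<open>Adding \<open>M - A\<close> makes the preimages open in the whole space, so no metric on \<open>A\<close> is needed.\<close>
  define O' where "O' i = (M - A) \<union> {z \<in> A. f z \<in> V i}" for i
  have opn: "openin Z (O' i)" if "i \<in> I" for i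
  proof -
    have "openin (subtopology Z A) {z \<in> topspace (subtopology Z A). f z \<in> V i}"
      using f V(1)[OF that] openin_continuous_map_preimage by blast
    then obtain S where "openin Z S" "{z \<in> topspace (subtopology Z A). f z \<in> V i} = S \<inter> A"
      unfolding openin_subtopology by auto
    moreover have "{z \<in> topspace (subtopology Z A). f z \<in> V i} = {z \<in> A. f z \<in> V i}"
      using AM by (auto simp: Z)
    ultimately have "openin Z S" "O' i = (M - A) \<union> S"
      using openin_subset[of Z S] by (auto simp: O'_def Z)
    then show ?thesis
      using A by (auto simp: closedin_def Z)
  qed
  then have "\<And>i. i \<in> I \<Longrightarrow> openin mtopology (O' i)"
    by (simp add: Z)
  then obtain F where "discrete_refinement I O' F"
    using discrete_refinement_exists by blast
  then have
    F: "\<And>n i. i \<in> I \<Longrightarrow> closedin mtopology (F n i)"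
      "\<And>n i x. i \<in> I \<Longrightarrow> x \<in> F n i \<Longrightarrow> mball x (1 / Suc n) \<subseteq> O' i"
      "\<And>n i j x y. i \<in> I \<Longrightarrow> j \<in> I \<Longrightarrow> i \<noteq> j \<Longrightarrow> x \<in> F n i \<Longrightarrow> y \<in> F n j \<Longrightarrow> 1 / Suc n \<le> d x y"
      "(\<Union>i\<in>I. O' i) \<subseteq> (\<Union>n. \<Union>i\<in>I. F n i)"
    unfolding discrete_refinement_def by auto
  have fF: "f ` (F n i \<inter> A) \<subseteq> V i" if "i \<in> I" for n i
  proof -
    have "x \<in> O' i" if "x \<in> F n i \<inter> A" for x
      using F(2)[OF \<open>i \<in> I\<close>, of x n] that AM by force
    then show ?thesis
      by (auto simp: O'_def)
  qed
  \<comment> \<open>\<open>P\<close> is the invariant of a stage; \<open>Q n\<close> says that the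
    next stage extends the current one and has level \<open>n\<close> in the interior of its
    domain.\<close>
  define P where "P = (\<lambda>(C, g). closedin Z C \<and> A \<subseteq> C \<and> continuous_map (subtopology Z C) W g \<and> (\<forall>z\<in>A. g z = f z))"
  define Q where "Q = (\<lambda>n (C, g) (C', g' :: 'z \<Rightarrow> 'w). C \<subseteq> C' \<and> (\<forall>z\<in>C. g' z = g z) \<and>
      (\<Union>i\<in>I. F n i \<inter> A) \<subseteq> Z interior_of C')"
  have "\<exists>c. \<forall>n. P (c n) \<and> Q n (c n) (c (Suc n))"
  proof (rule dependent_nat_choice)
    show "\<exists>c. P c"
      using A f by (auto simp: P_def)
    fix c and n :: nat assume "P c"
    then obtain C g where c: "c = (C, g)" "closedin Z C" "A \<subseteq> C" "continuous_map (subtopology Z C) W g" "\<forall>z\<in>A. g z = f z"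
      by (cases c) (auto simp: P_def)
    have 1: "closedin mtopology (F n i \<inter> A)" "F n i \<inter> A \<subseteq> C" "g ` (F n i \<inter> A) \<subseteq> V i" if "i \<in> I" for i
      using F(1)[OF that] A fF[OF that, of n] c(3,5) by (auto simp: Z)
    have 2: "1 / Suc n \<le> d x y" if "i \<in> I" "j \<in> I" "i \<noteq> j" "x \<in> F n i \<inter> A" "y \<in> F n j \<inter> A" for i j x y
      using F(3)[OF that(1-3)] that by blast
    show "\<exists>c'. P c' \<and> Q n c c'"
    proof (rule ANE_extend_near_discrete_family[where C = C and W = W and g = g and I = I and V = V
          and F = "\<lambda>i. F n i \<inter> A" and e = "1 / Suc n"])
      fix C' g'
      assume "closedin mtopology C'" "C \<subseteq> C'" "continuous_map (subtopology mtopology C') W g'"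
        "\<And>z. z \<in> C \<Longrightarrow> g' z = g z" "(\<Union>i\<in>I. F n i \<inter> A) \<subseteq> mtopology interior_of C'"
      then have "P (C', g') \<and> Q n c (C', g')"
        using c by (auto simp: P_def Q_def Z)
      then show "\<exists>c'. P c' \<and> Q n c c'"
        by blast
    next
      show "closedin mtopology C" "continuous_map (subtopology mtopology C) W g"
        using c by (simp_all add: Z)
    qed (simp_all add: V 1 2 del: of_nat_Suc)
  qed
  then obtain c where c: "\<And>n. P (c n)" "\<And>n. Q n (c n) (c (Suc n))"
    by blast
  define C where "C n = fst (c n)" for n
  define g where "g n = snd (c n)" for n
  have cC: "c n = (C n, g n)" for n
    by (simp add: C_def g_def)
  have P: "A \<subseteq> C n" "continuous_map (subtopology Z (C n)) W (g n)" "\<And>z. z\<in>A \<Longrightarrow> g n z = f z" for n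
    using c(1)[of n] by (auto simp: P_def cC)
  have Q: "C n \<subseteq> C (Suc n)" "\<And>z. z \<in> C n \<Longrightarrow> g (Suc n) z = g n z" "(\<Union>i\<in>I. F n i \<inter> A) \<subseteq> Z interior_of C (Suc n)" for n
    using c(2)[of n] by (auto simp: Q_def cC)
  have mono: "C m \<subseteq> C n" if "m \<le> n" for m n
    using that Q(1) by (rule lift_Suc_mono_le[rotated])
  have gle: "g n z = g m z" if "m \<le> n" "z \<in> C m" for m n z
    using that
  proof (induction rule: dec_induct)
    case (step n)
    then show ?case using Q(2)[of z n] mono[of m n] by auto
  qed simp
  have gg: "g m z = g n z" if "z \<in> C m" "z \<in> C n" for m n z
    using gle[of m n z] gle[of n m z] that by (cases "m \<le> n") auto
  define U where "U = (\<Union>n. Z interior_of C n)"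
  have U: "openin Z U"
    unfolding U_def by (intro openin_Union) auto
  have intC: "Z interior_of C n \<subseteq> C n" for n
    by (rule interior_of_subset)
  have UZ: "U \<subseteq> topspace Z"
    using U openin_subset by blast
  obtain G where G: "continuous_map (subtopology Z U) W G"
    and Gg: "\<And>x n. \<lbrakk>n \<in> UNIV; x \<in> topspace (subtopology Z U) \<inter> Z interior_of C n\<rbrakk> \<Longrightarrow> G x = g n x"
  proof (rule pasting_lemma_exists[where X = "subtopology Z U" and I = UNIV and T = "\<lambda>n. Z interior_of C n" and Y = W and f = g])
    show "topspace (subtopology Z U) \<subseteq> (\<Union>n. Z interior_of C n)"
      by (auto simp: U_def)
    fix m n :: nat and x
    show "openin (subtopology Z U) (Z interior_of C n)"
      using U by (auto simp: openin_open_subtopology U_def)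
    show "continuous_map (subtopology (subtopology Z U) (Z interior_of C n)) W (g n)"
      using continuous_map_from_subtopology_mono[OF P(2)[of n], of "U \<inter> Z interior_of C n"] intC
      by (auto simp: subtopology_subtopology le_infI2)
    show "g m x = g n x" if "x \<in> topspace (subtopology Z U) \<inter> Z interior_of C m \<inter> Z interior_of C n"
      using gg[of x m n] that intC by blast
  qed auto
  have AU: "A \<subseteq> U"
  proof
    fix z assume "z \<in> A"
    then obtain i where "i \<in> I" "f z \<in> V i"
      using cov fW by blast
    then have "z \<in> (\<Union>i\<in>I. O' i)"
      using \<open>z \<in> A\<close> by (auto simp: O'_def)
    then obtain n where "z \<in> (\<Union>i\<in>I. F n i \<inter> A)"
      using F(4) \<open>z \<in> A\<close> by blast
    then show "z \<in> U"
      using Q(3) by (auto simp: U_def)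
  qed
  have "G z = f z" if z: "z \<in> A" for z
  proof -
    obtain n where "z \<in> Z interior_of C n"
      using AU z by (auto simp: U_def)
    then have "G z = g n z"
      using Gg[of n z] UZ AU z by auto
    then show ?thesis
      using P(3)[OF z] by simp
  qed
  then show "\<exists>U g. openin Z U \<and> A \<subseteq> U \<and> continuous_map (subtopology Z U) W g \<and> (\<forall>z\<in>A. g z = f z)"
    using U AU G by blast
qed

section \<open>Test spaces smaller than the continuum\<close>

text \<open>A nonempty open interval has as many points as the real line, so it cannot fit inside an
  image of \<open>'a\<close>. This is how the bound on the size of the test type enters.\<close>

lemma ex_real_between_avoiding_range:
  fixes \<phi> :: "'a \<Rightarrow> real"
  assumes "\<not> (UNIV :: real set) \<lesssim> (UNIV :: 'a set)" "a < b"
  shows "\<exists>r. a < r \<and> r < b \<and> r \<notin> range \<phi>"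
proof (rule ccontr)
  assume "\<not> ?thesis"
  then have "{a<..<b} \<subseteq> range \<phi>"
    by auto
  have "(UNIV :: real set) \<approx> {a<..<b}"
    using open_interval_eqpoll_reals[of a b] assms(2) eqpoll_sym by blast
  then have "(UNIV :: real set) \<lesssim> {a<..<b}"
    by (rule eqpoll_imp_lepoll)
  also have "\<dots> \<lesssim> range \<phi>"
    by (rule subset_imp_lepoll) fact
  also have "range \<phi> \<lesssim> (UNIV :: 'a set)"
    by (rule image_lepoll)
  finally show False
    using assms(1) by blast
qed

text \<open>The distance \<open>m\<close> from \<open>x\<close> to the closed set \<open>A\<close>
  is positive, so \<open>m < 2 * m\<close> and some point of \<open>A\<close> is closer than
  \<open>2 * m\<close>. An exact nearest point need not exist.\<close>

lemma (in Metric_space) almost_nearest_point: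
  assumes A: "closedin mtopology A" "A \<noteq> {}" and x: "x \<in> M - A"
  shows "\<exists>a\<in>A. \<forall>b\<in>A. d x a \<le> 2 * d x b"
proof -
  have AM: "A \<subseteq> M"
    using A closedin_subset by fastforce
  have "openin mtopology (M - A)"
    using A by (simp add: closedin_def)
  then obtain r where r: "r > 0" "mball x r \<subseteq> M - A"
    using x unfolding openin_mtopology by blast
  define m where "m = Inf (d x ` A)"
  have "r \<le> m"
    unfolding m_def
  proof (rule cInf_greatest)
    show "d x ` A \<noteq> {}"
      using A by blast
    fix t assume "t \<in> d x ` A"
    then obtain b where b: "b \<in> A" "t = d x b"
      by blast
    then have "b \<notin> mball x r"
      using r by blast
    then show "r \<le> t"
      using b AM x by auto
  qed
  have m: "m \<le> d x b" if "b \<in> A" for b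
    unfolding m_def using that by (intro cInf_lower bdd_belowI[of _ 0]) auto
  have "m < 2 * m"
    using \<open>r > 0\<close> \<open>r \<le> m\<close> by simp
  then obtain a where "a \<in> A" "d x a < 2 * m"
    using cInf_lessD[of "d x ` A" "2 * m"] A unfolding m_def by blast
  then show ?thesis
    using m by force
qed

text \<open>Off \<open>A\<close> the retraction is locally constant, built from clopen sets that
  exist because the type is small. It moves a point by at most five times its distance to any point
  of \<open>A\<close>, which gives continuity on \<open>A\<close>.\<close>

proposition (in Metric_space) closed_retract_if_small:
  assumes small: "\<not> (UNIV :: real set) \<lesssim> (UNIV :: 'a set)"
    and A: "closedin mtopology A" "A \<noteq> {}"
  obtains \<rho> where "continuous_map mtopology (subtopology mtopology A) \<rho>" "\<And>a. a \<in> A \<Longrightarrow> \<rho> a = a"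
proof -
  have AM: "A \<subseteq> M"
    using A closedin_subset by fastforce
  define N where "N = M - A"
  have N: "openin mtopology N" "N \<subseteq> M"
    using A by (auto simp: closedin_def N_def)
  \<comment> \<open>The refinement below is taken in the complement of \<open>A\<close> as a metric
    space of its own; \<open>Ntop\<close> carries open sets back.\<close>
  interpret N: Metric_space N d
    using N(2) by (rule subspace)
  have Ntop: "openin mtopology S" if "openin N.mtopology S" for S
  proof -
    interpret Submetric M d N
      using N(2) by unfold_locales
    have "openin (subtopology mtopology N) S"
      using that mtopology_submetric by simp
    then show ?thesis
      using N(1) openin_trans_full by blast
  qed
  have "\<forall>x\<in>N. \<exists>a. a \<in> A \<and> (\<forall>b\<in>A. d x a \<le> 2 * d x b)"
    using almost_nearest_point[OF A] by (auto simp: N_def)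
  then obtain \<alpha> where \<alpha>: "\<And>x. x \<in> N \<Longrightarrow> \<alpha> x \<in> A" "\<And>x b. x \<in> N \<Longrightarrow> b \<in> A \<Longrightarrow> d x (\<alpha> x) \<le> 2 * d x b"
    unfolding bchoice_iff by blast
  define U where "U x = N.mball x (d x (\<alpha> x) / 4)" for x
  \<comment> \<open>With \<open>D = d x (\<alpha> x)\<close>, every \<open>b\<close> in
    \<open>A\<close> is at least \<open>D / 2\<close> from \<open>x\<close>, hence more than
    \<open>D / 4\<close> from \<open>z\<close>, while \<open>\<alpha> x\<close> is at most
    \<open>5 * D / 4\<close> from \<open>z\<close>.\<close>
  have \<alpha>U: "d z (\<alpha> x) \<le> 5 * d z b" if "x \<in> N" "z \<in> U x" "b \<in> A" for x z b
  proof -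
    have *: "x \<in> M" "z \<in> M" "b \<in> M" "\<alpha> x \<in> M" "d x z < d x (\<alpha> x) / 4"
      using that \<alpha>(1) N(2) AM by (auto simp: U_def)
    have "d x b \<le> d x z + d z b" "d z (\<alpha> x) \<le> d x z + d x (\<alpha> x)"
      using triangle[of x z b] triangle''[of z x "\<alpha> x"] * by auto
    then show ?thesis
      using \<alpha>(2)[OF that(1) that(3)] * by linarith
  qed
  have "\<And>x. x \<in> N \<Longrightarrow> openin N.mtopology (U x)"
    by (simp add: U_def)
  then obtain F where "N.discrete_refinement N U F"
    using N.discrete_refinement_exists by blast
  then have F: "\<And>n x p. x \<in> N \<Longrightarrow> p \<in> F n x \<Longrightarrow> N.mball p (1 / Suc n) \<subseteq> U x"
      "\<And>n x y p q. x \<in> N \<Longrightarrow> y \<in> N \<Longrightarrow> x \<noteq> y \<Longrightarrow> p \<in> F n x \<Longrightarrow> q \<in> F n y \<Longrightarrow> 1 / Suc n \<le> d p q"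
      "(\<Union>x\<in>N. U x) \<subseteq> (\<Union>n. \<Union>x\<in>N. F n x)"
    and Fcl: "\<And>n x. x \<in> N \<Longrightarrow> closedin N.mtopology (F n x)"
    unfolding N.discrete_refinement_def by auto
  have FN: "p \<in> N" if "x \<in> N" "p \<in> F n x" for n x p
    using closedin_subset[OF Fcl[OF that(1)], of n] that(2) by auto
  define P where "P n = (\<Union>x\<in>N. F n x)" for n
  have PN: "P n \<subseteq> N" for n
    using FN by (auto simp: P_def)
  \<comment> \<open>A radius that is not a value of the distance to \<open>P n\<close> makes the neighbourhood \<open>C n\<close> below clopen.\<close>
  have "\<forall>n. \<exists>r. 0 < r \<and> r < 1 / (2 * Suc n) \<and> r \<notin> range (\<lambda>z. Inf ((\<lambda>p. d p z) ` P n))"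
    using ex_real_between_avoiding_range[OF small] by simp
  then obtain r where r: "\<And>n. 0 < r n" "\<And>n. r n < 1 / (2 * Suc n)"
    "\<And>n. r n \<notin> range (\<lambda>z. Inf ((\<lambda>p. d p z) ` P n))"
    unfolding choice_iff by blast
  define C where "C n = {z \<in> N. \<exists>p\<in>P n. d p z < r n}" for n
  \<comment> \<open>The distance \<open>m\<close> from \<open>z\<close> to \<open>P n\<close> is at
    least \<open>r n\<close> and differs from it by the choice of \<open>r\<close>, so the ball of
    radius \<open>m - r n\<close> stays outside \<open>C n\<close>.\<close>
  have Ccl: "openin N.mtopology (N - C n)" for n
    unfolding N.openin_mtopology
  proof (intro conjI allI impI)
    fix z assume z: "z \<in> N - C n"
    show "\<exists>e>0. N.mball z e \<subseteq> N - C n"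
    proof (cases "P n = {}")
      case True
      then show ?thesis
        by (intro exI[of _ 1]) (auto simp: C_def)
    next
      case False
      define m where "m = Inf ((\<lambda>p. d p z) ` P n)"
      have "r n \<le> m"
        unfolding m_def using False z by (intro cInf_greatest) (auto simp: C_def not_less)
      moreover have "r n \<noteq> m"
        using r(3)[of n] unfolding m_def by blast
      ultimately have "m - r n > 0"
        by simp
      moreover have "N.mball z (m - r n) \<subseteq> N - C n"
      proof
        fix y assume y: "y \<in> N.mball z (m - r n)"
        have "r n \<le> d p y" if p: "p \<in> P n" for p
        proof -
          have "m \<le> d p z"
            unfolding m_def using p by (intro cInf_lower bdd_belowI[of _ 0]) auto
          moreover have "d p z \<le> d p y + d z y"
            using N.triangle'[of p y z] PN p y by auto
          ultimately show ?thesis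
            using y by auto
        qed
        then show "y \<in> N - C n"
          using y by (force simp: C_def)
      qed
      ultimately show ?thesis
        by blast
    qed
  qed auto
  have covers: "\<exists>n. z \<in> C n" if zN: "z \<in> N" for z
  proof -
    have "\<alpha> z \<in> M" "\<alpha> z \<noteq> z"
      using \<alpha>(1)[OF zN] AM zN by (auto simp: N_def)
    then have "z \<in> U z"
      using zN N(2) by (auto simp: U_def)
    then obtain n where "z \<in> P n"
      using F(3) zN unfolding P_def by blast
    then show ?thesis
      using zN r(1)[of n] by (auto simp: C_def intro!: exI[of _ n] bexI[of _ z])
  qed
  \<comment> \<open>The first level that reaches \<open>z\<close>. Like the index
    \<open>\<xi> z\<close> below, it is locally constant: the sets \<open>C k\<close> are clopen,
    and the members of one level are separated.\<close>
  define \<nu> where "\<nu> z = (LEAST n. z \<in> C n)" for z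
  have \<nu>: "z \<in> C (\<nu> z)" if "z \<in> N" for z
    unfolding \<nu>_def using covers[OF that] by (rule LeastI_ex)
  define near where "near n x z \<longleftrightarrow> x \<in> N \<and> (\<exists>p\<in>F n x. d p z < r n)" for n x z
  \<comment> \<open>Two points within \<open>r n\<close> of \<open>z\<close> are closer to each
    other than the separation of level \<open>n\<close>, since \<open>r n\<close> is below half of
    it.\<close>
  have near_unique: "x = y" if xy: "near n x z" "near n y z" and z: "z \<in> N" for n x y z
  proof (rule ccontr)
    assume "x \<noteq> y"
    obtain p q where pq: "p \<in> F n x" "q \<in> F n y" "d p z < r n" "d q z < r n" "x \<in> N" "y \<in> N"
      using xy by (auto simp: near_def)
    then have "1 / Suc n \<le> d p q"
      using F(2) \<open>x \<noteq> y\<close> by blast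
    also have "d p q \<le> d p z + d q z"
      using N.triangle'[of p z q] FN pq z by blast
    also have "\<dots> < 2 * (1 / (2 * Suc n))"
      using pq r(2)[of n] by linarith
    finally show False
      by (simp add: field_simps)
  qed
  define \<xi> where "\<xi> z = (SOME x. near (\<nu> z) x z)" for z
  have \<xi>: "near (\<nu> z) (\<xi> z) z" if "z \<in> N" for z
  proof -
    have "\<exists>x. near (\<nu> z) x z"
      using \<nu>[OF that] by (auto simp: C_def P_def near_def)
    then show ?thesis
      unfolding \<xi>_def by (rule someI_ex)
  qed
  have U\<xi>: "\<xi> z \<in> N" "z \<in> U (\<xi> z)" if z: "z \<in> N" for z
  proof -
    obtain p where p: "\<xi> z \<in> N" "p \<in> F (\<nu> z) (\<xi> z)" "d p z < r (\<nu> z)"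
      using \<xi>[OF z] by (auto simp: near_def)
    have "1 / (2 * Suc (\<nu> z)) \<le> 1 / Suc (\<nu> z)"
      by (simp add: field_simps)
    then have "d p z < 1 / Suc (\<nu> z)"
      using p(3) r(2)[of "\<nu> z"] by linarith
    then have "z \<in> N.mball p (1 / Suc (\<nu> z))"
      using FN[OF p(1,2)] z by simp
    then show "\<xi> z \<in> N" "z \<in> U (\<xi> z)"
      using F(1)[OF p(1,2)] p(1) by auto
  qed
  define \<rho> where "\<rho> z = (if z \<in> A then z else \<alpha> (\<xi> z))" for z
  have \<rho>A: "\<rho> z \<in> A" if "z \<in> M" for z
    using that \<alpha>(1) U\<xi>(1)[of z] by (auto simp: \<rho>_def N_def)
  have "continuous_map mtopology mtopology \<rho>"
    unfolding continuous_map_to_metric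
  proof (intro ballI allI impI)
    fix z and e :: real assume "z \<in> topspace mtopology" and e: "e > 0"
    then have zM: "z \<in> M"
      by simp
    show "\<exists>V. openin mtopology V \<and> z \<in> V \<and> (\<forall>y\<in>V. \<rho> y \<in> mball (\<rho> z) e)"
    proof (cases "z \<in> A")
      case True
      \<comment> \<open>\<open>\<rho>\<close> moves \<open>y\<close> by at most
        \<open>5 * d y z\<close>, so the image is within \<open>6 * d z y\<close> of
        \<open>z\<close>; hence the radius \<open>e / 6\<close>.\<close>
      have "\<rho> y \<in> mball (\<rho> z) e" if y: "y \<in> mball z (e / 6)" for y
      proof -
        have yM: "y \<in> M" and yz: "d z y < e / 6"
          using y by auto
        have "d y (\<rho> y) \<le> 5 * d y z"
        proof (cases "y \<in> A")
          case True
          then show ?thesis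
            using yM by (simp add: \<rho>_def)
        next
          case False
          then have "y \<in> N"
            using yM by (simp add: N_def)
          then show ?thesis
            using \<alpha>U[OF U\<xi>[OF \<open>y \<in> N\<close>] \<open>z \<in> A\<close>] False by (simp add: \<rho>_def)
        qed
        moreover have "d z (\<rho> y) \<le> d z y + d y (\<rho> y)"
          using triangle[of z y "\<rho> y"] zM yM \<rho>A[OF yM] AM by blast
        ultimately have "d z (\<rho> y) < e"
          using yz by (simp add: commute)
        then show ?thesis
          using \<open>z \<in> A\<close> zM \<rho>A[OF yM] AM by (auto simp: \<rho>_def)
      qed
      then show ?thesis
        using zM e by (intro exI[of _ "mball z (e / 6)"]) auto
    next
      case False
      then have z: "z \<in> N"
        using zM by (simp add: N_def)
      obtain p where p: "\<xi> z \<in> N" "p \<in> F (\<nu> z) (\<xi> z)" "d p z < r (\<nu> z)"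
        using \<xi>[OF z] by (auto simp: near_def)
      \<comment> \<open>On this neighbourhood of \<open>z\<close> no level before
        \<open>\<nu> z\<close> is reached and level \<open>\<nu> z\<close> is reached through the
        same index, so \<open>\<rho>\<close> is constant on it.\<close>
      define V where "V = N.mball p (r (\<nu> z)) \<inter> (N \<inter> (\<Inter>k\<in>{..<\<nu> z}. N - C k))"
      have V: "openin N.mtopology V"
      proof -
        have "openin N.mtopology (N \<inter> (\<Inter>k\<in>{..<\<nu> z}. N - C k))"
          by (rule openin_Int_Inter) (use Ccl in auto)
        then show ?thesis
          unfolding V_def by (rule openin_Int[OF N.openin_mball])
      qed
      have "z \<notin> C k" if "k < \<nu> z" for k
        using not_less_Least[of k "\<lambda>n. z \<in> C n"] that by (simp add: \<nu>_def)
      then have zV: "z \<in> V"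
        using z p FN[OF p(1,2)] by (auto simp: V_def)
      have \<rho>V: "\<rho> y = \<rho> z" if y: "y \<in> V" for y
      proof -
        have yN: "y \<in> N" and py: "d p y < r (\<nu> z)"
          using y by (auto simp: V_def)
        have yC: "y \<notin> C k" if "k < \<nu> z" for k
          using y that unfolding V_def by blast
        have "y \<in> C (\<nu> z)"
          using yN py p by (auto simp: C_def P_def)
        then have \<nu>y: "\<nu> y = \<nu> z"
          unfolding \<nu>_def[of y] using yC by (intro Least_equality leI) blast+
        have "near (\<nu> z) (\<xi> z) y"
          using p py by (auto simp: near_def)
        then have "\<xi> y = \<xi> z"
          using near_unique[OF \<xi>[OF yN]] yN \<nu>y by simp
        moreover have "y \<notin> A"
          using yN by (simp add: N_def)
        ultimately show ?thesis
          using False by (simp add: \<rho>_def)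
      qed
      have "\<rho> z \<in> mball (\<rho> z) e"
        using \<rho>A[OF zM] AM e by auto
      then have "\<forall>y\<in>V. \<rho> y \<in> mball (\<rho> z) e"
        by (intro ballI) (simp only: \<rho>V)
      then show ?thesis
        using Ntop[OF V] zV by blast
    qed
  qed
  then have "continuous_map mtopology (subtopology mtopology A) \<rho>"
    using \<rho>A by (auto simp: continuous_map_in_subtopology)
  then show thesis
    using that by (simp add: \<rho>_def)
qed

corollary ANE_if_small:
  assumes "\<not> (UNIV :: real set) \<lesssim> (UNIV :: 'z set)"
  shows "ANE TYPE('z) W"
  unfolding ANE_def
proof (intro allI impI)
  fix Z :: "'z topology" and A f
  assume "metrizable_space Z \<and> closedin Z A \<and> continuous_map (subtopology Z A) W f"
  then obtain M d where M: "Metric_space M d" and Z: "Z = Metric_space.mtopology M d"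
    and A: "closedin Z A" and f: "continuous_map (subtopology Z A) W f"
    unfolding metrizable_space_def by blast
  show "\<exists>U g. openin Z U \<and> A \<subseteq> U \<and> continuous_map (subtopology Z U) W g \<and> (\<forall>z\<in>A. g z = f z)"
  proof (cases "A = {}")
    case True
    \<comment> \<open>A nonempty space has no retraction onto the empty set; here the empty
      neighbourhood suffices.\<close>
    then show ?thesis
      using f by (intro exI[of _ "{}"] exI[of _ f]) auto
  next
    case False
    obtain \<rho> where \<rho>: "continuous_map Z (subtopology Z A) \<rho>" "\<And>a. a \<in> A \<Longrightarrow> \<rho> a = a"
      using Metric_space.closed_retract_if_small[OF M assms A[unfolded Z] False] unfolding Z by blast
    have "continuous_map (subtopology Z (topspace Z)) W (f \<circ> \<rho>)"
      using continuous_map_compose[OF \<rho>(1) f] by simp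
    then show ?thesis
      using \<rho>(2) closedin_subset[OF A] by (intro exI[of _ "topspace Z"] exI[of _ "f \<circ> \<rho>"]) auto
  qed
qed

section \<open>Retracts and open subsets\<close>

text \<open>Extend \<open>s \<circ> f\<close> into \<open>W'\<close> and return by \<open>r\<close>.
  With two maps in place of an inclusion, the result also yields invariance under
  homeomorphism.\<close>

lemma ANE_retract:
  assumes s: "continuous_map W W' s" and r: "continuous_map W' W r"
    and rs: "\<And>x. x \<in> topspace W \<Longrightarrow> r (s x) = x" and W': "ANE TYPE('z) W'"
  shows "ANE TYPE('z) W"
  unfolding ANE_def
proof (intro allI impI)
  fix Z :: "'z topology" and A f
  assume "metrizable_space Z \<and> closedin Z A \<and> continuous_map (subtopology Z A) W f"
  then have Z: "metrizable_space Z" and A: "closedin Z A" and f: "continuous_map (subtopology Z A) W f"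
    by auto
  obtain U g where U: "openin Z U" "A \<subseteq> U" "continuous_map (subtopology Z U) W' g" "\<And>z. z \<in> A \<Longrightarrow> g z = (s \<circ> f) z"
    using ANE_D[OF W' Z A continuous_map_compose[OF f s]] by metis
  have "f z \<in> topspace W" if "z \<in> A" for z
    using f closedin_subset[OF A] that by (auto simp: continuous_map_def Pi_iff)
  then have "\<forall>z\<in>A. (r \<circ> g) z = f z"
    using U(4) rs by auto
  then show "\<exists>U g. openin Z U \<and> A \<subseteq> U \<and> continuous_map (subtopology Z U) W g \<and> (\<forall>z\<in>A. g z = f z)"
    using U continuous_map_compose[OF U(3) r] by blast
qed

lemma ANE_homeomorphic_space:
  assumes "W homeomorphic_space W'"
  shows "ANE TYPE('z) W \<longleftrightarrow> ANE TYPE('z) W'"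
proof -
  obtain s r where "homeomorphic_maps W W' s r"
    using assms unfolding homeomorphic_space_def by blast
  then show ?thesis
    using ANE_retract[of W W' s r] ANE_retract[of W' W r s] unfolding homeomorphic_maps_def by blast
qed

text \<open>An extension into \<open>W\<close> takes values in \<open>V\<close> on an open set
  around \<open>A\<close>, to which it is restricted.\<close>

lemma ANE_open_subset:
  assumes W: "ANE TYPE('z) W" and V: "openin W V"
  shows "ANE TYPE('z) (subtopology W V)"
  unfolding ANE_def
proof (intro allI impI)
  fix Z :: "'z topology" and A f
  assume "metrizable_space Z \<and> closedin Z A \<and> continuous_map (subtopology Z A) (subtopology W V) f"
  then have Z: "metrizable_space Z" and A: "closedin Z A" and f: "continuous_map (subtopology Z A) W f" and fV: "f ` A \<subseteq> V"
    using closedin_subset[of Z A] by (auto simp: continuous_map_in_subtopology)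
  obtain U g where U: "openin Z U" "A \<subseteq> U" "continuous_map (subtopology Z U) W g" "\<And>z. z \<in> A \<Longrightarrow> g z = f z"
    using ANE_D[OF W Z A f] by metis
  define U' where "U' = {z \<in> topspace (subtopology Z U). g z \<in> V}"
  have U': "openin Z U'"
    unfolding U'_def using openin_continuous_map_preimage[OF U(3) V] U(1) openin_trans_full by blast
  have "A \<subseteq> U'"
    using U fV closedin_subset[OF A] by (auto simp: U'_def)
  moreover have "continuous_map (subtopology Z U') (subtopology W V) g"
  proof -
    have "continuous_map (subtopology Z U') W g"
      by (rule continuous_map_from_subtopology_mono[OF U(3)]) (auto simp: U'_def)
    then show ?thesis
      by (auto simp: continuous_map_in_subtopology U'_def)
  qed
  ultimately show "\<exists>U g. openin Z U \<and> A \<subseteq> U \<and> continuous_map (subtopology Z U) (subtopology W V) g \<and> (\<forall>z\<in>A. g z = f z)"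
    using U' U(4) by blast
qed

section \<open>The enveloping space\<close>

text \<open>As the space is built with \<open>topology\<close>, the axioms have to be verified. For
  intersections this rests on disjointness of the classes: a point common to two unions of classes
  lies in a common class.\<close>

lemma openin_quotient_topology:
  assumes "equiv (topspace P) R"
  shows "openin (quotient_topology P R) U \<longleftrightarrow> U \<subseteq> topspace P // R \<and> openin P (\<Union>U)"
proof -
  have "istopology (\<lambda>U. U \<subseteq> topspace P // R \<and> openin P (\<Union>U))"
    unfolding istopology_def
  proof (intro conjI allI impI)
    fix S T
    assume ST: "S \<subseteq> topspace P // R \<and> openin P (\<Union>S)" "T \<subseteq> topspace P // R \<and> openin P (\<Union>T)"
    have "\<Union>S \<inter> \<Union>T \<subseteq> \<Union>(S \<inter> T)"
    proof
      fix x assume "x \<in> \<Union>S \<inter> \<Union>T"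
      then obtain s t where st: "s \<in> S" "t \<in> T" "x \<in> s" "x \<in> t"
        by blast
      then have "s = t"
        using quotient_disj[OF assms, of s t] ST by blast
      then show "x \<in> \<Union>(S \<inter> T)"
        using st by blast
    qed
    then have "\<Union>(S \<inter> T) = \<Union>S \<inter> \<Union>T"
      by blast
    then show "openin P (\<Union>(S \<inter> T))" "S \<inter> T \<subseteq> topspace P // R"
      using ST by auto
  next
    fix K assume K: "\<forall>U\<in>K. U \<subseteq> topspace P // R \<and> openin P (\<Union>U)"
    then show "\<Union>K \<subseteq> topspace P // R"
      by blast
    have "\<Union>(\<Union>K) = (\<Union>U\<in>K. \<Union>U)"
      by blast
    then show "openin P (\<Union>(\<Union>K))"
      using K by (metis (no_types, lifting) imageE openin_Union)
  qed
  then show ?thesis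
    unfolding quotient_topology_def by (simp add: topology_inverse')
qed

lemma topspace_quotient_topology:
  assumes "equiv (topspace P) R"
  shows "topspace (quotient_topology P R) = topspace P // R"
proof -
  have "openin (quotient_topology P R) (topspace P // R)"
    using assms by (simp add: openin_quotient_topology Union_quotient)
  then show ?thesis
    using openin_quotient_topology[OF assms] by (metis openin_subset openin_topspace subset_antisym)
qed

text \<open>The locale is interpreted twice at the end, for the given action on \<open>Y\<close> and
  for the induced one on the function space.\<close>

locale nice_action =
  fixes G :: "('g, 'b) monoid_scheme" (structure) and T :: "'g topology"
    and W :: "'w topology" and D :: "'g \<Rightarrow> 'w set" and th :: "'g \<Rightarrow> 'w \<Rightarrow> 'w"
  assumes topological_group: "topological_group G T"
    and nice: "nice_partial_action G T W D th"
begin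

sublocale group G
  using topological_group by (simp add: topological_group_def)

lemma topspace_T: "topspace T = carrier G"
  using topological_group by (simp add: topological_group_def)

lemma partial_action: "topological_partial_action G W D th"
  using nice by (simp add: nice_partial_action_def)

lemma openin_D: "g \<in> carrier G \<Longrightarrow> openin W (D g)"
  using partial_action by (simp add: topological_partial_action_def)

lemma D_subset: "g \<in> carrier G \<Longrightarrow> D g \<subseteq> topspace W"
  using openin_D openin_subset by blast

lemma D_one: "D \<one> = topspace W"
  using partial_action by (simp add: topological_partial_action_def)

lemma th_one: "y \<in> topspace W \<Longrightarrow> th \<one> y = y"
  using partial_action by (simp add: topological_partial_action_def)

lemma th_homeomorphic_maps:
  "g \<in> carrier G \<Longrightarrow> homeomorphic_maps (subtopology W (D (inv g))) (subtopology W (D g)) (th g) (th (inv g))"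
  using partial_action by (simp add: topological_partial_action_def)

lemma th_in_D: "g \<in> carrier G \<Longrightarrow> y \<in> D (inv g) \<Longrightarrow> th g y \<in> D g"
  using th_homeomorphic_maps[of g] D_subset[of "inv g"] D_subset[of g]
  by (auto simp: homeomorphic_maps_def continuous_map_def Pi_iff)

lemma th_inv_th: "g \<in> carrier G \<Longrightarrow> y \<in> D (inv g) \<Longrightarrow> th (inv g) (th g y) = y"
  using th_homeomorphic_maps[of g] D_subset[of "inv g"] by (auto simp: homeomorphic_maps_def)

lemma th_comp:
  assumes "g \<in> carrier G" "h \<in> carrier G" "y \<in> D (inv h)" "th h y \<in> D (inv g)"
  shows "y \<in> D (inv (g \<otimes> h))" "th g (th h y) = th (g \<otimes> h) y"
  using partial_action assms unfolding topological_partial_action_def by blast+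

definition "R = envelope_rel G W D th"

abbreviation "E \<equiv> enveloping_space G T W D th"

lemma R_iff:
  "((g, x), (h, y)) \<in> R \<longleftrightarrow> g \<in> carrier G \<and> h \<in> carrier G \<and> x \<in> D (inv g \<otimes> h) \<and> th (inv h \<otimes> g) x = y"
  using D_subset[of "inv g \<otimes> h"] by (auto simp: R_def envelope_rel_def)

lemma inv_mult_inv: "g \<in> carrier G \<Longrightarrow> h \<in> carrier G \<Longrightarrow> inv (inv g \<otimes> h) = inv h \<otimes> g"
  by (simp add: inv_mult_group)

lemma R_sym: "((g, x), (h, y)) \<in> R \<Longrightarrow> ((h, y), (g, x)) \<in> R"
  using th_in_D[of "inv h \<otimes> g" x] th_inv_th[of "inv h \<otimes> g" x] by (auto simp: R_iff inv_mult_inv)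

text \<open>The composition law is applied to \<open>inv l \<otimes> h\<close> and
  \<open>inv h \<otimes> g\<close>, whose product is \<open>inv l \<otimes> g\<close>.\<close>

lemma R_trans:
  assumes "((g, x), (h, y)) \<in> R" "((h, y), (l, z)) \<in> R"
  shows "((g, x), (l, z)) \<in> R"
proof -
  have c: "g \<in> carrier G" "h \<in> carrier G" "l \<in> carrier G"
    using assms by (auto simp: R_iff)
  have "(inv l \<otimes> h) \<otimes> (inv h \<otimes> g) = inv l \<otimes> g"
    using c by (metis inv_closed inv_solve_left' m_assoc m_closed)
  then show ?thesis
    using th_comp[of "inv l \<otimes> h" "inv h \<otimes> g" x] assms c by (auto simp: R_iff inv_mult_inv)
qed

lemma equiv_R: "equiv (topspace (prod_topology T W)) R"
proof (rule equivI)
  show "R \<subseteq> topspace (prod_topology T W) \<times> topspace (prod_topology T W)"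
  proof (rule subrelI)
    fix p q assume "(p, q) \<in> R"
    then obtain g x h y where pq: "p = (g, x)" "q = (h, y)" and *: "((g, x), (h, y)) \<in> R"
      by (cases p; cases q) auto
    show "(p, q) \<in> topspace (prod_topology T W) \<times> topspace (prod_topology T W)"
      using * R_sym[OF *] D_subset[of "inv g \<otimes> h"] D_subset[of "inv h \<otimes> g"]
      by (auto simp: R_iff topspace_T pq)
  qed
  show "refl_on (topspace (prod_topology T W)) R"
    by (auto simp: refl_on_def R_iff topspace_T D_one th_one)
  show "sym R"
    using R_sym by (auto simp: sym_def)
  show "trans R"
    using R_trans by (auto simp: trans_def)
qed

lemma openin_E: "openin E U \<longleftrightarrow> U \<subseteq> topspace (prod_topology T W) // R \<and> openin (prod_topology T W) (\<Union>U)"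
  unfolding enveloping_space_def R_def[symmetric] by (rule openin_quotient_topology[OF equiv_R])

lemma topspace_E: "topspace E = topspace (prod_topology T W) // R"
  unfolding enveloping_space_def R_def[symmetric] by (rule topspace_quotient_topology[OF equiv_R])

text \<open>Both halves of niceness are used: by continuity the set is relatively open in the domain
  of the action, and that domain is open.\<close>

lemma openin_th_preimage:
  assumes "openin W V"
  shows "openin (prod_topology T W) {(g, y). g \<in> carrier G \<and> y \<in> D (inv g) \<and> th g y \<in> V}"
proof -
  let ?S = "{(g, y). g \<in> carrier G \<and> y \<in> D (inv g)}"
  have S: "openin (prod_topology T W) ?S"
    and c: "continuous_map (subtopology (prod_topology T W) ?S) W (\<lambda>(g, y). th g y)"
    using nice by (auto simp: nice_partial_action_def)
  have "openin (subtopology (prod_topology T W) ?S)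
      {p \<in> topspace (subtopology (prod_topology T W) ?S). (\<lambda>(g, y). th g y) p \<in> V}"
    using openin_continuous_map_preimage[OF c assms] .
  moreover have "{p \<in> topspace (subtopology (prod_topology T W) ?S). (\<lambda>(g, y). th g y) p \<in> V} =
      {(g, y). g \<in> carrier G \<and> y \<in> D (inv g) \<and> th g y \<in> V}"
    using openin_subset[OF S] by auto
  ultimately have "openin (subtopology (prod_topology T W) ?S)
      {(g, y). g \<in> carrier G \<and> y \<in> D (inv g) \<and> th g y \<in> V}"
    by (simp only:)
  then show ?thesis
    using S by (rule openin_trans_full)
qed

section \<open>The open embeddings into the enveloping space\<close>

definition "emb g y = R `` {(g, y)}"

lemma emb_in_quotient: "g \<in> carrier G \<Longrightarrow> y \<in> topspace W \<Longrightarrow> emb g y \<in> topspace (prod_topology T W) // R"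
  unfolding emb_def by (rule quotientI) (simp add: topspace_T)

text \<open>The union of the classes \<open>emb g v\<close> with \<open>v\<close> in
  \<open>V\<close> consists of the pairs \<open>(h, y)\<close> for which
  \<open>inv g \<otimes> h\<close> acts on \<open>y\<close> with value in \<open>V\<close>. It is
  the preimage of an open set under left translation of the first coordinate.\<close>

lemma emb_open_map:
  assumes g: "g \<in> carrier G"
  shows "open_map W E (emb g)"
  unfolding open_map_def
proof (intro allI impI)
  fix V assume V: "openin W V"
  have VW: "V \<subseteq> topspace W"
    using V openin_subset by blast
  let ?O = "{(k, y). k \<in> carrier G \<and> y \<in> D (inv k) \<and> th k y \<in> V}"
  let ?f = "\<lambda>p. (inv g \<otimes> fst p, snd p)"
  have "continuous_map T T (\<lambda>h. inv g \<otimes> h)"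
  proof -
    have "continuous_map (prod_topology T T) T (\<lambda>(g, h). g \<otimes> h)"
      using topological_group by (simp add: topological_group_def)
    moreover have "continuous_map T (prod_topology T T) (\<lambda>h. (inv g, h))"
      using g by (auto simp: continuous_map_pairwise o_def topspace_T)
    ultimately have "continuous_map T T ((\<lambda>(g, h). g \<otimes> h) \<circ> (\<lambda>h. (inv g, h)))"
      by (rule continuous_map_compose[rotated])
    then show ?thesis
      by (simp add: o_def)
  qed
  from continuous_map_compose[OF continuous_map_fst this]
  have "continuous_map (prod_topology T W) (prod_topology T W) ?f"
    by (simp add: continuous_map_pairwise o_def continuous_map_snd)
  then have "openin (prod_topology T W) {p \<in> topspace (prod_topology T W). ?f p \<in> ?O}"
    using openin_continuous_map_preimage openin_th_preimage[OF V] by blast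
  moreover have "{p \<in> topspace (prod_topology T W). ?f p \<in> ?O} = \<Union>(emb g ` V)"
  proof (intro subset_antisym subsetI)
    fix p assume "p \<in> {p \<in> topspace (prod_topology T W). ?f p \<in> ?O}"
    then obtain h y where p: "p = (h, y)" "h \<in> carrier G" "y \<in> D (inv (inv g \<otimes> h))" "th (inv g \<otimes> h) y \<in> V"
      by (cases p) (auto simp: topspace_T)
    then have "((h, y), (g, th (inv g \<otimes> h) y)) \<in> R"
      using g by (simp add: R_iff inv_mult_inv)
    then have "p \<in> emb g (th (inv g \<otimes> h) y)"
      using R_sym p by (simp add: emb_def)
    then show "p \<in> \<Union>(emb g ` V)"
      using p by blast
  next
    fix p assume "p \<in> \<Union>(emb g ` V)"
    then obtain v where v: "v \<in> V" "((g, v), p) \<in> R"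
      by (auto simp: emb_def)
    obtain h y where p: "p = (h, y)"
      by (cases p)
    have "((h, y), (g, v)) \<in> R"
      using R_sym v p by blast
    then show "p \<in> {p \<in> topspace (prod_topology T W). ?f p \<in> ?O}"
      using p g v D_subset[of "inv h \<otimes> g"] by (auto simp: R_iff inv_mult_inv topspace_T)
  qed
  ultimately show "openin E (emb g ` V)"
    using emb_in_quotient[OF g] VW by (auto simp: openin_E)
qed

lemma emb_continuous:
  assumes g: "g \<in> carrier G"
  shows "continuous_map W E (emb g)"
  unfolding continuous_map_def
proof (intro conjI allI impI)
  show "emb g \<in> topspace W \<rightarrow> topspace E"
    using emb_in_quotient[OF g] by (simp add: topspace_E)
  fix U assume U: "openin E U"
  then have UQ: "U \<subseteq> topspace (prod_topology T W) // R" and op: "openin (prod_topology T W) (\<Union>U)"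
    by (auto simp: openin_E)
  have "continuous_map W (prod_topology T W) (\<lambda>y. (g, y))"
    using g by (auto simp: continuous_map_pairwise o_def topspace_T)
  then have "openin W {y \<in> topspace W. (g, y) \<in> \<Union>U}"
    using op openin_continuous_map_preimage by blast
  \<comment> \<open>Classes are disjoint, so the class of \<open>(g, y)\<close> is the only one that
    contains this pair.\<close>
  moreover have "(g, y) \<in> \<Union>U \<longleftrightarrow> emb g y \<in> U" if y: "y \<in> topspace W" for y
  proof
    assume "(g, y) \<in> \<Union>U"
    then obtain u where u: "u \<in> U" "(g, y) \<in> u"
      by blast
    have "(g, y) \<in> emb g y"
      unfolding emb_def using equiv_class_self[OF equiv_R] g y by (simp add: topspace_T)
    then have "emb g y = u"
      using quotient_disj[OF equiv_R emb_in_quotient[OF g y], of u] UQ u by blast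
    then show "emb g y \<in> U"
      using u by simp
  next
    assume "emb g y \<in> U"
    moreover have "(g, y) \<in> emb g y"
      unfolding emb_def using equiv_class_self[OF equiv_R] g y by (simp add: topspace_T)
    ultimately show "(g, y) \<in> \<Union>U"
      by blast
  qed
  ultimately show "openin W {y \<in> topspace W. emb g y \<in> U}"
    by (simp cong: conj_cong)
qed

text \<open>Between pairs with equal group component the relation reduces to the action of
  \<open>\<one>\<close>, which is the identity.\<close>

lemma emb_inj: 
  assumes g: "g \<in> carrier G"
  shows "inj_on (emb g) (topspace W)"
proof
  fix x y assume xy: "x \<in> topspace W" "y \<in> topspace W" "emb g x = emb g y"
  then have "((g, x), (g, y)) \<in> R"
    unfolding emb_def using eq_equiv_class_iff[OF equiv_R] g by (simp add: topspace_T)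
  then show "x = y"
    using xy g by (simp add: R_iff th_one)
qed

lemma W_homeomorphic_emb_image:
  assumes g: "g \<in> carrier G"
  shows "W homeomorphic_space subtopology E (emb g ` topspace W)"
  using injective_open_imp_embedding_map[OF emb_continuous[OF g] emb_open_map[OF g] emb_inj[OF g]]
  by (rule embedding_map_imp_homeomorphic_space)

text \<open>One direction restricts to the open copy of \<open>W\<close> belonging to
  \<open>\<one>\<close>; the other uses the cover of \<open>E\<close> by the copies for all group
  elements.\<close>

proposition ANE_enveloping_space_iff: "ANE TYPE('z) W \<longleftrightarrow> ANE TYPE('z) E"
proof
  have opn: "openin E (emb g ` topspace W)" if "g \<in> carrier G" for g
    using emb_open_map[OF that] by (simp add: open_map_def)
  show "ANE TYPE('z) W" if "ANE TYPE('z) E"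
    using ANE_open_subset[OF that opn] ANE_homeomorphic_space[OF W_homeomorphic_emb_image] one_closed by blast
  show "ANE TYPE('z) E" if W: "ANE TYPE('z) W"
  proof (rule ANE_if_union_of_open_ANE)
    show "openin E (emb g ` topspace W)" if "g \<in> carrier G" for g
      using opn that .
    show "ANE TYPE('z) (subtopology E (emb g ` topspace W))" if "g \<in> carrier G" for g
      using W ANE_homeomorphic_space[OF W_homeomorphic_emb_image[OF that]] by blast
    show "topspace E \<subseteq> (\<Union>g\<in>carrier G. emb g ` topspace W)"
      unfolding topspace_E by (auto simp: quotient_def emb_def topspace_T)
  qed
qed

end

section \<open>The induced action on the function space\<close>

lemma topspace_compact_open_topology: "topspace (compact_open_topology X Y) = cmaps X Y"
proof -
  \<comment> \<open>Taking the compact set empty exhibits all of \<open>cmaps X Y\<close> as a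
    subbasic open set.\<close>
  have "{f \<in> cmaps X Y. f ` {} \<subseteq> topspace Y} \<in> {{f \<in> cmaps X Y. f ` K \<subseteq> U} | K U. compactin X K \<and> openin Y U}"
    by blast
  then show ?thesis
    unfolding compact_open_topology_def topology_generated_by_topspace by auto
qed

lemma openin_compact_open_topology:
  "compactin X K \<Longrightarrow> openin Y U \<Longrightarrow> openin (compact_open_topology X Y) {f \<in> cmaps X Y. f ` K \<subseteq> U}"
  unfolding compact_open_topology_def by (rule topology_generated_by_Basis) blast

lemma continuous_map_into_compact_open_topology:
  assumes "\<And>z. z \<in> topspace S \<Longrightarrow> \<phi> z \<in> cmaps X Y"
    and "\<And>K U. compactin X K \<Longrightarrow> openin Y U \<Longrightarrow> openin S {z \<in> topspace S. \<phi> z ` K \<subseteq> U}"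
  shows "continuous_map S (compact_open_topology X Y) \<phi>"
  unfolding compact_open_topology_def
proof (rule continuous_on_generated_topo)
  fix V assume "V \<in> {{f \<in> cmaps X Y. f ` K \<subseteq> U} | K U. compactin X K \<and> openin Y U}"
  then obtain K U where V: "V = {f \<in> cmaps X Y. f ` K \<subseteq> U}" "compactin X K" "openin Y U"
    by blast
  have "\<phi> -` V \<inter> topspace S = {z \<in> topspace S. \<phi> z ` K \<subseteq> U}"
    using assms(1) by (auto simp: V)
  then show "openin S (\<phi> -` V \<inter> topspace S)"
    using assms(2) V by simp
next
  show "\<phi> ` topspace S \<subseteq> \<Union>{{f \<in> cmaps X Y. f ` K \<subseteq> U} | K U. compactin X K \<and> openin Y U}"
    using assms(1) topspace_compact_open_topology[of X Y]
    unfolding compact_open_topology_def topology_generated_by_topspace by auto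
qed

lemma cmapsD: "f \<in> cmaps X Y \<Longrightarrow> continuous_map X Y f"
  by (simp add: cmaps_def)

text \<open>The tube lemma around \<open>g\<close> and the compact image of \<open>K\<close> under
  \<open>f\<close> yields an open box, which becomes an open set of \<open>T\<close> times a
  subbasic set. This serves both for the domain of the induced action and for its
  continuity.\<close>

lemma openin_family_maps_into:
  assumes O: "openin (prod_topology T Y) O'" and K: "compactin X K"
  shows "openin (prod_topology T (compact_open_topology X Y))
    {(g, f). g \<in> topspace T \<and> f \<in> cmaps X Y \<and> (\<forall>x\<in>K. (g, f x) \<in> O')}"
    (is "openin _ ?S")
proof (subst openin_subopen, intro ballI)
  fix p assume "p \<in> ?S"
  then obtain g f where p: "p = (g, f)" "g \<in> topspace T" "f \<in> cmaps X Y" "\<And>x. x \<in> K \<Longrightarrow> (g, f x) \<in> O'"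
    by auto
  have c1: "compactin Y (f ` K)"
    using image_compactin[OF K cmapsD[OF p(3)]] .
  have c2: "{g} \<times> f ` K \<subseteq> O'"
    using p by auto
  obtain U V where UV: "openin T U" "openin Y V" "g \<in> U" "f ` K \<subseteq> V" "U \<times> V \<subseteq> O'"
    using tube_lemma_right[OF O c1 p(2) c2] by blast
  let ?N = "U \<times> {f \<in> cmaps X Y. f ` K \<subseteq> V}"
  have "openin (prod_topology T (compact_open_topology X Y)) ?N"
    using UV openin_compact_open_topology[OF K UV(2)] by (simp add: openin_prod_Times_iff)
  moreover have "p \<in> ?N"
    using p UV by auto
  moreover have "?N \<subseteq> ?S"
    using UV openin_subset[OF UV(1)] by auto
  ultimately show "\<exists>N. openin (prod_topology T (compact_open_topology X Y)) N \<and> p \<in> N \<and> N \<subseteq> ?S"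
    by blast
qed

context nice_action
begin

lemma hat_act_in_cmaps:
  assumes g: "g \<in> carrier G" and f: "f \<in> hat_dom X W D (inv g)"
  shows "hat_act X th g f \<in> cmaps X W"
proof -
  have "continuous_map X (subtopology W (D (inv g))) f"
    using f by (auto simp: hat_dom_def cmaps_def continuous_map_in_subtopology)
  moreover have "continuous_map (subtopology W (D (inv g))) W (th g)"
    using th_homeomorphic_maps[OF g] unfolding homeomorphic_maps_def
    using continuous_map_into_fulltopology by blast
  ultimately have "continuous_map X W (th g \<circ> f)"
    by (rule continuous_map_compose)
  then have "continuous_map X W (hat_act X th g f)"
    by (rule continuous_map_eq) (simp add: hat_act_def)
  then show ?thesis
    by (simp add: cmaps_def hat_act_def)
qed

lemma hat_act_in_hat_dom:
  assumes "g \<in> carrier G" "f \<in> hat_dom X W D (inv g)"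
  shows "hat_act X th g f \<in> hat_dom X W D g"
  using hat_act_in_cmaps[OF assms] assms th_in_D[OF assms(1)] unfolding hat_dom_def by (auto simp: hat_act_def)

proposition nice_partial_action_hat:
  assumes X: "compact_space X"
  shows "nice_partial_action G T (compact_open_topology X W) (hat_dom X W D) (hat_act X th)"
proof -
  let ?C = "compact_open_topology X W"
  let ?S = "{(g, f). g \<in> carrier G \<and> f \<in> hat_dom X W D (inv g)}"
  have KX: "compactin X (topspace X)"
    using X by (simp add: compact_space_def)
  \<comment> \<open>Compactness of \<open>X\<close> permits \<open>K = topspace X\<close>, so the
    domain of the induced action is an instance of \<open>openin_family_maps_into\<close>.\<close>
  have S: "?S = {(g, f). g \<in> topspace T \<and> f \<in> cmaps X W \<and>
      (\<forall>x\<in>topspace X. (g, f x) \<in> {(g, y). g \<in> carrier G \<and> y \<in> D (inv g)})}"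
    by (auto simp: hat_dom_def topspace_T)
  have openS: "openin (prod_topology T ?C) ?S"
    unfolding S using nice by (intro openin_family_maps_into KX) (simp add: nice_partial_action_def)
  have topS: "topspace (subtopology (prod_topology T ?C) ?S) = ?S"
    using openin_subset[OF openS] by auto
  have cont: "continuous_map (subtopology (prod_topology T ?C) ?S) ?C (\<lambda>(g, f). hat_act X th g f)"
  proof (rule continuous_map_into_compact_open_topology)
    fix z assume "z \<in> topspace (subtopology (prod_topology T ?C) ?S)"
    then show "(\<lambda>(g, f). hat_act X th g f) z \<in> cmaps X W"
      unfolding topS using hat_act_in_cmaps by auto
  next
    fix K U assume K: "compactin X K" and U: "openin W U"
    have KX: "K \<subseteq> topspace X"
      using K compactin_subset_topspace by blast
    let ?O = "{(g, y). g \<in> carrier G \<and> y \<in> D (inv g) \<and> th g y \<in> U}"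
    \<comment> \<open>Read pointwise on \<open>K\<close>, the preimage of a subbasic set is again
      such a family, now for the open set \<open>?O\<close>, cut down to the domain.\<close>
    have "{z \<in> topspace (subtopology (prod_topology T ?C) ?S). (\<lambda>(g, f). hat_act X th g f) z ` K \<subseteq> U} =
        {(g, f). g \<in> topspace T \<and> f \<in> cmaps X W \<and> (\<forall>x\<in>K. (g, f x) \<in> ?O)} \<inter> ?S"
      (is "?L = ?R")
    proof -
      have *: "(g, f) \<in> ?L \<longleftrightarrow> (g, f) \<in> ?R" for g f
      proof (cases "g \<in> carrier G \<and> f \<in> hat_dom X W D (inv g)")
        case True
        have "hat_act X th g f ` K \<subseteq> U \<longleftrightarrow> (\<forall>x\<in>K. th g (f x) \<in> U)"
          using KX by (auto simp: hat_act_def subset_iff)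
        moreover have "f x \<in> D (inv g)" if "x \<in> K" for x
          using True KX that by (auto simp: hat_dom_def)
        moreover have "f \<in> cmaps X W"
          using True by (simp add: hat_dom_def)
        ultimately show ?thesis
          using True by (simp only: topS) (simp add: topspace_T)
      next
        case False
        then show ?thesis
          by (simp only: topS) auto
      qed
      show ?thesis
      proof (rule Set.set_eqI)
        fix p show "p \<in> ?L \<longleftrightarrow> p \<in> ?R"
          using *[of "fst p" "snd p"] by (simp only: prod.collapse)
      qed
    qed
    then show "openin (subtopology (prod_topology T ?C) ?S)
        {z \<in> topspace (subtopology (prod_topology T ?C) ?S). (\<lambda>(g, f). hat_act X th g f) z ` K \<subseteq> U}"
      by (simp only: openin_subtopology_Int[OF openin_family_maps_into[OF openin_th_preimage[OF U] K]])
  qed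
  have dom_open: "openin ?C (hat_dom X W D g)" if "g \<in> carrier G" for g
    unfolding hat_dom_def by (rule openin_compact_open_topology[OF KX openin_D[OF that]])
  have hcont: "continuous_map (subtopology ?C (hat_dom X W D (inv g))) (subtopology ?C (hat_dom X W D g)) (hat_act X th g)"
    if g: "g \<in> carrier G" for g
  proof -
    \<comment> \<open>Continuity of a single \<open>hat_act X th g\<close> follows from joint
      continuity along the slice at \<open>g\<close>.\<close>
    have "continuous_map (subtopology ?C (hat_dom X W D (inv g))) (subtopology (prod_topology T ?C) ?S) (\<lambda>f. (g, f))"
      using g by (auto simp: continuous_map_in_subtopology continuous_map_pairwise o_def topspace_T)
    from continuous_map_compose[OF this cont]
    have "continuous_map (subtopology ?C (hat_dom X W D (inv g))) ?C (hat_act X th g)"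
      by (simp add: o_def)
    then show ?thesis
      using hat_act_in_hat_dom[OF g] by (auto simp: continuous_map_in_subtopology)
  qed
  have hinv: "hat_act X th (inv g) (hat_act X th g f) = f" if "g \<in> carrier G" "f \<in> hat_dom X W D (inv g)" for g f
  proof
    fix x show "hat_act X th (inv g) (hat_act X th g f) x = f x"
      using that th_inv_th[of g "f x"] by (auto simp: hat_act_def hat_dom_def cmaps_def)
  qed
  have "topological_partial_action G ?C (hat_dom X W D) (hat_act X th)"
    unfolding topological_partial_action_def
  proof (intro conjI ballI impI)
    show "hat_dom X W D \<one> = topspace ?C"
      unfolding topspace_compact_open_topology hat_dom_def D_one
      by (auto simp: cmaps_def continuous_map_def Pi_iff)
    show "hat_act X th \<one> f = f" if "f \<in> topspace ?C" for f
      using that unfolding topspace_compact_open_topology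
      by (auto simp: hat_act_def cmaps_def continuous_map_def Pi_iff th_one fun_eq_iff)
  next
    fix g assume g: "g \<in> carrier G"
    show "openin ?C (hat_dom X W D g)"
      using dom_open g .
    show "homeomorphic_maps (subtopology ?C (hat_dom X W D (inv g))) (subtopology ?C (hat_dom X W D g))
        (hat_act X th g) (hat_act X th (inv g))"
      unfolding homeomorphic_maps_def using hcont[OF g] hcont[of "inv g"] hinv[OF g] hinv[of "inv g"] g by auto
  next
    fix g h f
    assume gh: "g \<in> carrier G" "h \<in> carrier G" and f: "f \<in> hat_dom X W D (inv h)" "hat_act X th h f \<in> hat_dom X W D (inv g)"
    have *: "f x \<in> D (inv (g \<otimes> h)) \<and> th g (th h (f x)) = th (g \<otimes> h) (f x)" if "x \<in> topspace X" for x
    proof -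
      have "f x \<in> D (inv h)" "th h (f x) \<in> D (inv g)"
        using f that by (auto simp: hat_dom_def hat_act_def)
      then show ?thesis
        using th_comp[OF gh] by blast
    qed
    show "f \<in> hat_dom X W D (inv (g \<otimes> h))"
      using * f by (auto simp: hat_dom_def)
    show "hat_act X th g (hat_act X th h f) = hat_act X th (g \<otimes> h) f"
      using * by (auto simp: hat_act_def)
  qed
  then show ?thesis
    unfolding nice_partial_action_def using openS cont by blast
qed

end

section \<open>ANE function spaces\<close>

text \<open>The predicate quantifies over topologies on \<open>'z\<close> only; a metrizable space
  on another type is copied to \<open>'z\<close> along an injection of its points.\<close>

lemma ANE_D_lepoll:
  fixes Q :: "'q topology"
  assumes W: "ANE TYPE('z) W" and small: "topspace Q \<lesssim> (UNIV :: 'z set)"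
    and Q: "metrizable_space Q" and B: "closedin Q B" and f: "continuous_map (subtopology Q B) W f"
  obtains U g where "openin Q U" "B \<subseteq> U" "continuous_map (subtopology Q U) W g" "\<And>q. q \<in> B \<Longrightarrow> g q = f q"
proof -
  obtain j :: "'q \<Rightarrow> 'z" where j: "inj_on j (topspace Q)"
    using small unfolding lepoll_def by blast
  define i where "i = inv_into (topspace Q) j"
  have ij: "i (j q) = q" if "q \<in> topspace Q" for q
    using j that by (simp add: i_def)
  \<comment> \<open>The pullback along the inverse \<open>i\<close> of the injection makes
    \<open>j\<close> a homeomorphism from \<open>Q\<close> to \<open>Z\<close>.\<close>
  define Z where "Z = pullback_topology (j ` topspace Q) i Q"
  have topZ: "topspace Z = j ` topspace Q"
    using ij by (auto simp: Z_def topspace_pullback_topology)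
  have cj: "continuous_map Q Z j"
    unfolding Z_def
  proof (rule continuous_map_pullback')
    show "continuous_map Q Q (i \<circ> j)"
      by (rule continuous_map_eq[OF continuous_map_id]) (simp add: ij)
  qed auto
  have ci: "continuous_map Z Q i"
    using continuous_map_pullback[OF continuous_map_id, of "j ` topspace Q" i Q] by (simp add: Z_def)
  have "homeomorphic_maps Q Z j i"
    unfolding homeomorphic_maps_def using cj ci ij by (auto simp: topZ)
  then have "metrizable_space Z"
    using Q homeomorphic_metrizable_space homeomorphic_maps_imp_homeomorphic_space by blast
  have BQ: "B \<subseteq> topspace Q"
    using B closedin_subset by blast
  define A where "A = {z \<in> topspace Z. i z \<in> B}"
  have A: "closedin Z A"
    unfolding A_def using ci B by (rule closedin_continuous_map_preimage)
  have "continuous_map (subtopology Z A) (subtopology Q B) i"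
    using ci by (auto simp: continuous_map_in_subtopology A_def continuous_map_from_subtopology)
  from continuous_map_compose[OF this f]
  have "continuous_map (subtopology Z A) W (f \<circ> i)" .
  then obtain U g where U: "openin Z U" "A \<subseteq> U" "continuous_map (subtopology Z U) W g" "\<And>z. z \<in> A \<Longrightarrow> g z = (f \<circ> i) z"
    using ANE_D[OF W \<open>metrizable_space Z\<close> A] by metis
  show thesis
  proof
    let ?U = "{q \<in> topspace Q. j q \<in> U}"
    show "openin Q ?U"
      using cj U(1) by (rule openin_continuous_map_preimage)
    have BA: "j q \<in> A" if "q \<in> B" for q
      using that BQ ij by (auto simp: A_def topZ)
    then show "B \<subseteq> ?U"
      using U(2) BQ by blast
    have "continuous_map (subtopology Q ?U) (subtopology Z U) j"
      using cj by (auto simp: continuous_map_in_subtopology continuous_map_from_subtopology)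
    then show "continuous_map (subtopology Q ?U) W (g \<circ> j)"
      using U(3) by (rule continuous_map_compose)
    show "(g \<circ> j) q = f q" if "q \<in> B" for q
      using U(4)[OF BA[OF that]] ij that BQ by auto
  qed
qed

text \<open>A point is determined by which members of a countable dense set lie within which radius
  \<open>1 / Suc n\<close> of it; the dense set is a union of finite nets given by total
  boundedness.\<close>

lemma compact_metrizable_lepoll_reals:
  assumes "compact_space X" "metrizable_space X"
  shows "topspace X \<lesssim> (UNIV :: real set)"
proof -
  obtain M d where "Metric_space M d" and X: "X = Metric_space.mtopology M d"
    using assms(2) unfolding metrizable_space_def by blast
  then interpret Metric_space M d by blast
  have "mtotally_bounded M"
    using assms(1) compactin_imp_mtotally_bounded by (simp add: X compact_space_def)
  then have "\<forall>n. \<exists>K. finite K \<and> K \<subseteq> M \<and> M \<subseteq> (\<Union>x\<in>K. mball x (1 / Suc n))"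
    unfolding mtotally_bounded_def by simp
  then obtain K where K: "\<And>n. finite (K n)" "\<And>n. M \<subseteq> (\<Union>x\<in>K n. mball x (1 / Suc n))"
    unfolding choice_iff by blast
  define c where "c = from_nat_into (\<Union>n. K n)"
  have c: "\<exists>m. c m = k" if "k \<in> K n" for k n
  proof -
    have "countable (\<Union>n. K n)"
      using K(1) by (intro countable_UN) (auto intro: countable_finite)
    then show ?thesis
      unfolding c_def using from_nat_into_surj[of "\<Union>n. K n" k] that by blast
  qed
  \<comment> \<open>\<open>prod_encode\<close> turns the set of pairs into a set of numbers, so the
    code of a point is a \<open>nat set\<close>, and there are continuum many of these.\<close>
  define \<phi> where "\<phi> x = prod_encode ` {(n, m). d (c m) x < 1 / Suc n}" for x
  have "inj_on \<phi> M"
  proof (rule inj_onI, rule ccontr)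
    fix x y assume xy: "x \<in> M" "y \<in> M" "\<phi> x = \<phi> y" "x \<noteq> y"
    then have "d x y / 2 > 0"
      by simp
    then obtain n where n: "1 / Suc n < d x y / 2"
      using nat_approx_posE by blast
    obtain k where k: "k \<in> K n" "k \<in> M" "d k x < 1 / Suc n"
      using K(2)[of n] xy(1) by auto
    obtain m where m: "c m = k"
      using c[OF k(1)] by blast
    have "{(n, m). d (c m) x < 1 / Suc n} = {(n, m). d (c m) y < 1 / Suc n}"
      using xy(3) unfolding \<phi>_def by (simp only: inj_image_eq_iff[OF inj_prod_encode])
    then have "d k y < 1 / Suc n"
      using k(3) m by blast
    moreover have "d x y \<le> d k x + d k y"
      using triangle''[of x k y] xy k by simp
    ultimately show False
      using n k(3) by linarith
  qed
  then have "M \<lesssim> (UNIV :: nat set set)"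
    unfolding lepoll_def by blast
  also have "(UNIV :: nat set set) \<lesssim> (UNIV :: real set)"
    using nat_sets_eqpoll_reals by (rule eqpoll_imp_lepoll)
  finally show ?thesis
    by (simp add: X)
qed

text \<open>An infinite cardinal equals its square.\<close>

lemma infinite_Times_lepoll_self:
  assumes "infinite (UNIV :: 'z set)" "B \<lesssim> (UNIV :: 'z set)"
  shows "(A :: 'z set) \<times> B \<lesssim> (UNIV :: 'z set)"
proof -
  have "A \<times> B \<lesssim> (UNIV :: 'z set) \<times> (UNIV :: 'z set)"
    using assms(2) by (intro times_lepoll_mono) (auto intro: subset_imp_lepoll)
  also have "(UNIV :: 'z set) \<times> (UNIV :: 'z set) \<lesssim> (UNIV :: 'z set)"
    using card_of_Times_same_infinite[OF assms(1)] ordIso_imp_ordLeq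
    unfolding lepoll_def by (metis card_of_ordLeq)
  finally show ?thesis .
qed

text \<open>Compact Hausdorff spaces are normal, so \<open>x\<close> has an open neighbourhood whose
  compact closure \<open>f\<close> still maps into \<open>U\<close>. The maps sending that closure
  into \<open>U\<close>, times the neighbourhood, form the required box.\<close>

lemma continuous_map_evaluation:
  assumes X: "compact_space X" "Hausdorff_space X"
  shows "continuous_map (prod_topology (compact_open_topology X Y) X) Y (\<lambda>(f, x). f x)"
  unfolding continuous_map_def
proof (intro conjI allI impI)
  let ?P = "prod_topology (compact_open_topology X Y) X"
  show "(\<lambda>(f, x). f x) \<in> topspace ?P \<rightarrow> topspace Y"
    by (auto simp: topspace_compact_open_topology cmaps_def continuous_map_def Pi_iff)
  fix U assume U: "openin Y U"
  show "openin ?P {p \<in> topspace ?P. (\<lambda>(f, x). f x) p \<in> U}" (is "openin _ ?S")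
  proof (subst openin_subopen, intro ballI)
    fix p assume "p \<in> ?S"
    then obtain f x where p: "p = (f, x)" "f \<in> cmaps X Y" "x \<in> topspace X" "f x \<in> U"
      by (auto simp: topspace_compact_open_topology)
    have f: "openin X {x \<in> topspace X. f x \<in> U}"
      using openin_continuous_map_preimage[OF cmapsD[OF p(2)] U] .
    have cl: "closedin X {x}"
      using p(3) X(2) by (simp add: closedin_Hausdorff_singleton)
    have "normal_space X"
      using X compact_Hausdorff_or_regular_imp_normal_space by blast
    then obtain V where V: "openin X V" "x \<in> V" "X closure_of V \<subseteq> {x \<in> topspace X. f x \<in> U}"
      using cl f p unfolding normal_space_alt by (metis (no_types, lifting) empty_subsetI insert_subset mem_Collect_eq)
    have K: "compactin X (X closure_of V)"
      using X(1) by (intro closedin_compact_space) auto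
    let ?N = "{f \<in> cmaps X Y. f ` (X closure_of V) \<subseteq> U} \<times> V"
    have "openin ?P ?N"
      using V openin_compact_open_topology[OF K U] by (simp add: openin_prod_Times_iff)
    moreover have "p \<in> ?N"
      using p V by auto
    moreover have "?N \<subseteq> ?S"
      using openin_subset[OF V(1)] closure_of_subset[of V X] by (auto simp: topspace_compact_open_topology)
    ultimately show "\<exists>N. openin ?P N \<and> p \<in> N \<and> N \<subseteq> ?S"
      by blast
  qed
qed

lemma openin_forall_compact:
  assumes "openin (prod_topology Z X) O'" "compactin X K"
  shows "openin Z {z \<in> topspace Z. \<forall>x\<in>K. (z, x) \<in> O'}" (is "openin _ ?S")
proof (subst openin_subopen, intro ballI)
  fix z assume z: "z \<in> ?S"
  then have "z \<in> topspace Z" "{z} \<times> K \<subseteq> O'"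
    by auto
  then obtain U V where UV: "openin Z U" "openin X V" "z \<in> U" "K \<subseteq> V" "U \<times> V \<subseteq> O'"
    using tube_lemma_right[OF assms] by meson
  then have "U \<subseteq> ?S"
    using openin_subset[OF UV(1)] by blast
  then show "\<exists>U. openin Z U \<and> z \<in> U \<and> U \<subseteq> ?S"
    using UV by blast
qed

text \<open>Uncurrying leads to an extension problem for \<open>A \<times> topspace X\<close> in
  \<open>Z \<times> X\<close>. The cardinality assumption provides a copy of this product on
  \<open>'z\<close>, where the hypothesis on \<open>Y\<close> applies.\<close>

lemma ANE_compact_open_topology_if_large:
  fixes X :: "'x topology" and Y :: "'y topology"
  assumes large: "(UNIV :: real set) \<lesssim> (UNIV :: 'z set)"
    and X: "compact_space X" "metrizable_space X" and Y: "ANE TYPE('z) Y"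
  shows "ANE TYPE('z) (compact_open_topology X Y)"
  unfolding ANE_def
proof (intro allI impI)
  fix Z :: "'z topology" and A and f :: "'z \<Rightarrow> 'x \<Rightarrow> 'y"
  let ?C = "compact_open_topology X Y"
  assume "metrizable_space Z \<and> closedin Z A \<and> continuous_map (subtopology Z A) ?C f"
  then have Z: "metrizable_space Z" and A: "closedin Z A" and f: "continuous_map (subtopology Z A) ?C f"
    by auto
  have AZ: "A \<subseteq> topspace Z"
    using A closedin_subset by blast
  have KX: "compactin X (topspace X)"
    using X by (simp add: compact_space_def)
  let ?Q = "prod_topology Z X"
  let ?B = "A \<times> topspace X"
  have "infinite (UNIV :: real set)"
    by (simp add: infinite_UNIV_char_0)
  then have "infinite (UNIV :: 'z set)"
    using large lepoll_trans infinite_le_lepoll by metis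
  moreover have "topspace X \<lesssim> (UNIV :: 'z set)"
    using compact_metrizable_lepoll_reals[OF X] large by (rule lepoll_trans)
  ultimately have small: "topspace ?Q \<lesssim> (UNIV :: 'z set)"
    unfolding topspace_prod_topology by (rule infinite_Times_lepoll_self)
  have Q: "metrizable_space ?Q"
    using Z X by (simp add: metrizable_space_prod_topology)
  have B: "closedin ?Q ?B"
    using A by (simp add: closedin_prod_Times_iff)
  have "continuous_map (prod_topology (subtopology Z A) X) (prod_topology ?C X) (\<lambda>(z, x). (f z, x))"
    using f by (simp add: continuous_map_prod_top)
  from continuous_map_compose[OF this continuous_map_evaluation[OF X(1) metrizable_imp_Hausdorff_space[OF X(2)]]]
  have "continuous_map (prod_topology (subtopology Z A) X) Y (\<lambda>(z, x). f z x)"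
    by (simp add: o_def case_prod_beta')
  moreover have "prod_topology (subtopology Z A) X = subtopology ?Q ?B"
    by (simp add: prod_topology_subtopology)
  ultimately have F: "continuous_map (subtopology ?Q ?B) Y (\<lambda>(z, x). f z x)"
    by simp
  obtain O' g where O: "openin ?Q O'" "?B \<subseteq> O'" and g: "continuous_map (subtopology ?Q O') Y g"
    and gf: "\<And>q. q \<in> ?B \<Longrightarrow> g q = (\<lambda>(z, x). f z x) q"
    using ANE_D_lepoll[OF Y small Q B F] by metis
  \<comment> \<open>These are the points whose whole fibre lies in the domain of the extension;
    compactness of \<open>X\<close> makes the set open.\<close>
  define U where "U = {z \<in> topspace Z. \<forall>x\<in>topspace X. (z, x) \<in> O'}"
  have U: "openin Z U"
    unfolding U_def using O(1) KX by (rule openin_forall_compact)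
  have AU: "A \<subseteq> U"
    using O(2) AZ by (auto simp: U_def)
  \<comment> \<open>Elements of \<open>cmaps X Y\<close> are \<open>undefined\<close> off the space,
    so the curried extension has to be as well.\<close>
  define \<phi> where "\<phi> z = (\<lambda>x. if x \<in> topspace X then g (z, x) else undefined)" for z
  have "continuous_map (subtopology Z U) ?C \<phi>"
  proof (rule continuous_map_into_compact_open_topology)
    fix z assume "z \<in> topspace (subtopology Z U)"
    then have "continuous_map X (subtopology ?Q O') (\<lambda>x. (z, x))"
      by (auto simp: continuous_map_in_subtopology continuous_map_pairwise o_def U_def)
    from continuous_map_compose[OF this g] have "continuous_map X Y (\<phi> z)"
      by (rule continuous_map_eq) (simp add: \<phi>_def)
    then show "\<phi> z \<in> cmaps X Y"
      by (simp add: cmaps_def \<phi>_def)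
  next
    fix K V assume K: "compactin X K" and V: "openin Y V"
    have KsX: "K \<subseteq> topspace X"
      using K compactin_subset_topspace by blast
    define O2 where "O2 = {q \<in> topspace (subtopology ?Q O'). g q \<in> V}"
    have "openin ?Q O2"
      unfolding O2_def using openin_continuous_map_preimage[OF g V] O(1) by (rule openin_trans_full)
    then have "openin Z {z \<in> topspace Z. \<forall>x\<in>K. (z, x) \<in> O2}"
      using K by (rule openin_forall_compact)
    then have "openin (subtopology Z U) ({z \<in> topspace Z. \<forall>x\<in>K. (z, x) \<in> O2} \<inter> U)"
      by (rule openin_subtopology_Int)
    moreover have "{z \<in> topspace Z. \<forall>x\<in>K. (z, x) \<in> O2} \<inter> U = {z \<in> topspace (subtopology Z U). \<phi> z ` K \<subseteq> V}"
      using KsX by (auto simp: O2_def U_def \<phi>_def subset_iff)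
    ultimately show "openin (subtopology Z U) {z \<in> topspace (subtopology Z U). \<phi> z ` K \<subseteq> V}"
      by (simp only:)
  qed
  moreover have "\<phi> z = f z" if "z \<in> A" for z
  proof
    have "f z \<in> cmaps X Y"
      using f that AZ by (auto simp: continuous_map_def Pi_iff topspace_compact_open_topology)
    then show "\<phi> z x = f z x" for x
      using gf[of "(z, x)"] that by (auto simp: \<phi>_def cmaps_def)
  qed
  ultimately show "\<exists>U g. openin Z U \<and> A \<subseteq> U \<and> continuous_map (subtopology Z U) ?C g \<and> (\<forall>z\<in>A. g z = f z)"
    using U AU by blast
qed

text \<open>Evaluation at a point is a left inverse of the embedding by constant maps. Conversely
  the size of \<open>'z\<close> decides: if it is below the continuum every space is an ANE for
  \<open>'z\<close>, otherwise currying applies.\<close>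

proposition ANE_compact_open_topology_iff:
  fixes X :: "'x topology" and Y :: "'y topology"
  assumes ne: "topspace X \<noteq> {}" and X: "compact_space X" "metrizable_space X"
  shows "ANE TYPE('z) (compact_open_topology X Y) \<longleftrightarrow> ANE TYPE('z) Y"
proof
  assume C: "ANE TYPE('z) (compact_open_topology X Y)"
  obtain x0 where x0: "x0 \<in> topspace X"
    using ne by blast
  define s where "s y = (\<lambda>x. if x \<in> topspace X then y else undefined)" for y :: 'y
  show "ANE TYPE('z) Y"
  proof (rule ANE_retract[OF _ _ _ C])
    show "continuous_map Y (compact_open_topology X Y) s"
    proof (rule continuous_map_into_compact_open_topology)
      fix y assume "y \<in> topspace Y"
      then have "continuous_map X Y (\<lambda>x. y)"
        by simp
      then have "continuous_map X Y (s y)"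
        by (rule continuous_map_eq) (simp add: s_def)
      then show "s y \<in> cmaps X Y"
        by (simp add: cmaps_def s_def)
    next
      fix K U assume K: "compactin X K" and U: "openin Y U"
      have "K \<subseteq> topspace X"
        using K compactin_subset_topspace by blast
      \<comment> \<open>An empty \<open>K\<close> imposes no condition on \<open>y\<close>, hence
        the case distinction.\<close>
      then have "{y \<in> topspace Y. s y ` K \<subseteq> U} = (if K = {} then topspace Y else U)"
        using openin_subset[OF U] by (auto simp: s_def)
      then show "openin Y {y \<in> topspace Y. s y ` K \<subseteq> U}"
        using U by simp
    qed
    have "continuous_map (compact_open_topology X Y) (prod_topology (compact_open_topology X Y) X) (\<lambda>f. (f, x0))"
      using x0 by (simp add: continuous_map_pairwise o_def)
    from continuous_map_compose[OF this continuous_map_evaluation[OF X(1) metrizable_imp_Hausdorff_space[OF X(2)]]]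
    show "continuous_map (compact_open_topology X Y) Y (\<lambda>f. f x0)"
      by (simp add: o_def)
    show "s y x0 = y" for y
      using x0 by (simp add: s_def)
  qed
next
  assume "ANE TYPE('z) Y"
  then show "ANE TYPE('z) (compact_open_topology X Y)"
    using ANE_compact_open_topology_if_large[OF _ X] ANE_if_small by blast
qed

theorem theorem3p16:
  fixes G :: "('g, 'b) monoid_scheme" and T :: "'g topology"
    and Y :: "'y topology" and D :: "'g \<Rightarrow> 'y set" and th :: "'g \<Rightarrow> 'y \<Rightarrow> 'y"
    and X :: "'x topology"
  assumes "topological_group G T" and "Hausdorff_space T"
    and "nice_partial_action G T Y D th"
    and "topspace X \<noteq> {}" and "compact_space X" and "metrizable_space X"
  shows "(ANE TYPE('z) Y \<longleftrightarrow> ANE TYPE('z) (enveloping_space G T Y D th)) \<and>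
         (ANE TYPE('z) (enveloping_space G T Y D th) \<longleftrightarrow>
            ANE TYPE('z) (enveloping_space G T (compact_open_topology X Y) (hat_dom X Y D) (hat_act X th))) \<and>
         (ANE TYPE('z) (enveloping_space G T (compact_open_topology X Y) (hat_dom X Y D) (hat_act X th)) \<longleftrightarrow>
            ANE TYPE('z) (compact_open_topology X Y))"
proof -
  interpret Y: nice_action G T Y D th
    using assms by unfold_locales
  interpret C: nice_action G T "compact_open_topology X Y" "hat_dom X Y D" "hat_act X th"
    using assms Y.nice_partial_action_hat by unfold_locales
  show ?thesis
    using Y.ANE_enveloping_space_iff[where 'z = 'z] C.ANE_enveloping_space_iff[where 'z = 'z]
      ANE_compact_open_topology_iff[OF assms(4-6), of Y, where 'z = 'z] by blast
qed

end
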